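(* Let $(V,g)$ be a real vector space of dimension $n+1$, $n\in\mathbb N$, with a positive definite inner product $g$ and a unit vector $\xi$; let $U=\mathrm{span}(\xi)$ and $D=U^\perp$. The $\mathrm{SO}(n)$-module $\mathcal Z(V)=U^*\otimes D^*\otimes D^*$ decomposes into $\mathrm{SO}(n)$-irreducible submodules as $$\mathcal Z(V)=\mathcal Z_1(V)+\mathcal Z_2(V)+\mathcal Z_3(V),$$ with explicit expressions $$\begin{aligned} \mathcal Z_1(V)&=\{S\in\mathcal Z(V): S_{XYZ}=\lambda\, g(Y,Z)g(X,\xi),\ \lambda\in\mathbb R\},\\ \mathcal Z_2(V)&=\{S\in\mathcal Z(V): S_{XYZ}=g(X,\xi)S_{\xi YZ},\ S_{\xi YZ}=S_{\xi ZY},\ c_{23}(S)=0\},\\ \mathcal Z_3(V)&=\{S\in\mathcal Z(V): S_{XYZ}=g(X,\xi)S_{\xi YZ},\ S_{\xi YZ}=-S_{\xi ZY}\}, \end{aligned}$$ where $c_{23}(S)(X)=\sum_{i=1}^nS_{Xe_ie_i}$ for any orthonormal basis $\{e_1,\dots,e_n\}$ of $D$.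
   Context: $\mathrm{SO}(n)=\mathrm{SO}(D)$ acts on $V=U\oplus D$ fixing $\xi$ and in the standard way on $D$, and acts on tensors accordingly. Elements of $U^*\otimes D^*\otimes D^*$ are trilinear forms $S_{XYZ}$ with $X\in U$ and $Y,Z\in D$ (extended by zero to $X\in D$); the defining identities are understood for all $X\in V$ and $Y,Z\in D$.
   Formalization: For n=4, irreducibility of Z_3(V) is not claimed: it is false, as Z_3 ≅ Λ²D* splits under SO(4) into self-dual and anti-self-dual forms. For n≤1 the vanishing summands (Z_1 if n=0; Z_2, Z_3 if n≤1) are stated to be zero instead of irreducible. *)

theory Defs
  imports "HOL-Analysis.Analysis"
begin

text \<open>
  The inner product space \<open>(V, g)\<close> is a type \<open>'a\<close> of class \<open>euclidean_space\<close> with \<open>g = (\<bullet>)\<close>.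
  Since \<open>V\<close> is finite-dimensional, every trilinear form on \<open>V\<close> is bounded, so the type below
  is the full space \<open>V\<^sup>* \<otimes> V\<^sup>* \<otimes> V\<^sup>*\<close>, with its library vector space structure.
\<close>

type_synonym 'a trilinear = "'a \<Rightarrow>\<^sub>L 'a \<Rightarrow>\<^sub>L 'a \<Rightarrow>\<^sub>L real"

definition line_of :: "'a::euclidean_space \<Rightarrow> 'a set"
  where "line_of \<xi> = span {\<xi>}"

definition dist_of :: "'a::euclidean_space \<Rightarrow> 'a set"
  where "dist_of \<xi> = (line_of \<xi>)\<^sup>\<bottom>"


subsection \<open>The group \<open>SO(D)\<close> and its action\<close>

text \<open>
  Leibniz formula in the orthonormal basis \<open>Basis\<close>; the library determinant covers only
  matrices indexed by a finite type (see \<open>lin_det_eq_det_matrix\<close> for the agreement).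
\<close>

definition lin_det :: "('a::euclidean_space \<Rightarrow> 'a) \<Rightarrow> real"
  where "lin_det f = (\<Sum>p | p permutes Basis. of_int (sign p) * (\<Prod>b\<in>Basis. f b \<bullet> p b))"

text \<open>
  An element of \<open>SO(D)\<close> is represented by its extension to \<open>V\<close> fixing \<open>\<xi>\<close>. Such a \<open>T\<close> is
  block diagonal with respect to \<open>V = U \<oplus> D\<close>, with entry 1 on \<open>U\<close>, so its determinant is that
  of its restriction to \<open>D\<close>.
\<close>

definition SO_D :: "'a::euclidean_space \<Rightarrow> ('a \<Rightarrow> 'a) set"
  where "SO_D \<xi> = {T. orthogonal_transformation T \<and> T \<xi> = \<xi> \<and> lin_det T = 1}"

definition tensor_act :: "('a::euclidean_space \<Rightarrow> 'a) \<Rightarrow> 'a trilinear \<Rightarrow> 'a trilinear"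
  where "tensor_act T S =
    Blinfun (\<lambda>X. Blinfun (\<lambda>Y. Blinfun (\<lambda>Z. S (inv T X) (inv T Y) (inv T Z))))"

definition SO_submodule :: "'a::euclidean_space \<Rightarrow> 'a trilinear set \<Rightarrow> bool"
  where "SO_submodule \<xi> M \<longleftrightarrow> subspace M \<and> (\<forall>T\<in>SO_D \<xi>. \<forall>S\<in>M. tensor_act T S \<in> M)"

definition SO_irreducible :: "'a::euclidean_space \<Rightarrow> 'a trilinear set \<Rightarrow> bool"
  where "SO_irreducible \<xi> M \<longleftrightarrow>
    SO_submodule \<xi> M \<and> M \<noteq> {0} \<and>
    (\<forall>N. SO_submodule \<xi> N \<and> N \<subseteq> M \<longrightarrow> N = {0} \<or> N = M)"


subsection \<open>The module \<open>U\<^sup>* \<otimes> D\<^sup>* \<otimes> D\<^sup>*\<close> and its distinguished subspaces\<close>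

text \<open>
  \<open>U\<^sup>*\<close> and \<open>D\<^sup>*\<close> are embedded in \<open>V\<^sup>*\<close> by extending forms by zero on \<open>D\<close> and \<open>U\<close> respectively.
\<close>

definition ZV :: "'a::euclidean_space \<Rightarrow> 'a trilinear set"
  where "ZV \<xi> = {S :: 'a trilinear. \<forall>X Y Z. X \<in> dist_of \<xi> \<or> Y \<in> line_of \<xi> \<or> Z \<in> line_of \<xi> \<longrightarrow> S X Y Z = 0}"

definition orthonormal_basis_of :: "'a::euclidean_space set \<Rightarrow> 'a set \<Rightarrow> bool"
  where "orthonormal_basis_of W B \<longleftrightarrow>
    pairwise orthogonal B \<and> (\<forall>e\<in>B. norm e = 1) \<and> span B = W"

text \<open>The choice of basis is immaterial, see \<open>c23_eq\<close> below.\<close>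

definition c23 :: "'a::euclidean_space \<Rightarrow> 'a trilinear \<Rightarrow> 'a \<Rightarrow> real"
  where "c23 \<xi> S X = (\<Sum>e\<in>(SOME B. orthonormal_basis_of (dist_of \<xi>) B). S X e e)"

definition Z1 :: "'a::euclidean_space \<Rightarrow> 'a trilinear set"
  where "Z1 \<xi> = {S \<in> ZV \<xi>. \<exists>c::real. \<forall>X. \<forall>Y\<in>dist_of \<xi>. \<forall>Z\<in>dist_of \<xi>.
    S X Y Z = c * (Y \<bullet> Z) * (X \<bullet> \<xi>)}"

definition Z2 :: "'a::euclidean_space \<Rightarrow> 'a trilinear set"
  where "Z2 \<xi> = {S \<in> ZV \<xi>.
    (\<forall>X. \<forall>Y\<in>dist_of \<xi>. \<forall>Z\<in>dist_of \<xi>. S X Y Z = (X \<bullet> \<xi>) * S \<xi> Y Z) \<and>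
    (\<forall>Y\<in>dist_of \<xi>. \<forall>Z\<in>dist_of \<xi>. S \<xi> Y Z = S \<xi> Z Y) \<and>
    (\<forall>X. c23 \<xi> S X = 0)}"

text \<open>
  For \<open>dim D = 4\<close> the next module is not irreducible: it is isomorphic to \<open>\<Lambda>\<^sup>2 D\<^sup>*\<close>, which splits
  under \<open>SO(4)\<close> into self-dual and anti-self-dual forms.
\<close>

definition Z3 :: "'a::euclidean_space \<Rightarrow> 'a trilinear set"
  where "Z3 \<xi> = {S \<in> ZV \<xi>.
    (\<forall>X. \<forall>Y\<in>dist_of \<xi>. \<forall>Z\<in>dist_of \<xi>. S X Y Z = (X \<bullet> \<xi>) * S \<xi> Y Z) \<and>
    (\<forall>Y\<in>dist_of \<xi>. \<forall>Z\<in>dist_of \<xi>. S \<xi> Y Z = - S \<xi> Z Y)}"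


subsection \<open>Consistency of the definitions\<close>

lemma lin_det_eq_det_matrix:
  fixes f :: "real ^ 'n \<Rightarrow> real ^ 'n"
  shows "lin_det f = det (matrix f)"
proof -
  let ?a = "\<lambda>i::'n. axis i (1::real)"
  have inj: "inj ?a" by (auto simp: inj_on_def axis_eq_axis)
  have B: "(Basis :: (real^'n) set) = range ?a"
    by (auto simp: Basis_vec_def)
  have bij: "bij_betw ?a UNIV (Basis :: (real^'n) set)"
    using inj B by (simp add: bij_betw_def)
  let ?m = "map_permutation UNIV ?a"
  have bijp: "bij_betw ?m {p. p permutes UNIV} {p. p permutes (Basis :: (real^'n) set)}"
  proof -
    have "?m = (\<lambda>p x. if x \<in> (Basis :: (real^'n) set) then ?a (p (inv_into UNIV ?a x)) else x)"
      by (simp add: fun_eq_iff map_permutation_def restrict_id_def B)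
    with bij_betw_permutations[OF bij] show ?thesis by simp
  qed
  have "lin_det f = (\<Sum>p | p permutes (UNIV::'n set). of_int (sign (?m p)) * (\<Prod>b\<in>Basis. f b \<bullet> ?m p b))"
    unfolding lin_det_def by (rule sum.reindex_bij_betw[OF bijp, symmetric])
  also have "\<dots> = (\<Sum>p | p permutes (UNIV::'n set). of_int (sign p) * (\<Prod>i\<in>UNIV. transpose (matrix f) $ i $ p i))"
  proof (rule sum.cong[OF refl])
    fix p :: "'n \<Rightarrow> 'n" assume "p \<in> {p. p permutes UNIV}"
    then have p: "p permutes UNIV" by simp
    have "sign (?m p) = sign p"
      using inj p by (intro sign_map_permutation) auto
    moreover have "(\<Prod>b\<in>Basis. f b \<bullet> ?m p b) = (\<Prod>i\<in>UNIV. f (?a i) \<bullet> ?m p (?a i))"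
      by (rule prod.reindex_bij_betw[OF bij, symmetric])
    moreover have "\<dots> = (\<Prod>i\<in>UNIV. transpose (matrix f) $ i $ p i)"
      by (simp add: map_permutation_apply[OF inj UNIV_I] transpose_def matrix_def inner_axis)
    ultimately show "of_int (sign (?m p)) * (\<Prod>b\<in>Basis. f b \<bullet> ?m p b) =
      of_int (sign p) * (\<Prod>i\<in>UNIV. transpose (matrix f) $ i $ p i)" by simp
  qed
  also have "\<dots> = det (transpose (matrix f))" by (simp add: det_def)
  finally show ?thesis by simp
qed

lemma tensor_act_apply:
  fixes S :: "'a::euclidean_space trilinear"
  assumes "orthogonal_transformation T"
  shows "tensor_act T S X Y Z = S (inv T X) (inv T Y) (inv T Z)"
proof -
  have lin: "linear (inv T)"
    using assms orthogonal_transformation_inv orthogonal_transformation_linear by blast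
  have inv_add: "inv T (a + b) = inv T a + inv T b" for a b by (rule linear_add[OF lin])
  have inv_scale: "inv T (c *\<^sub>R a) = c *\<^sub>R inv T a" for c a by (rule linear_scale[OF lin])
  note simps = inv_add inv_scale blinfun.add_left blinfun.add_right
    blinfun.scaleR_left blinfun.scaleR_right
  have b3: "bounded_linear (\<lambda>Z. S (inv T X) (inv T Y) (inv T Z))" for X Y
    unfolding linear_conv_bounded_linear[symmetric] by (intro linearI) (simp_all add: simps)
  have b2: "bounded_linear (\<lambda>Y. Blinfun (\<lambda>Z. S (inv T X) (inv T Y) (inv T Z)))" for X
    unfolding linear_conv_bounded_linear[symmetric]
    by (intro linearI; intro blinfun_eqI)
      (simp_all only: plus_blinfun.rep_eq scaleR_blinfun.rep_eq bounded_linear_Blinfun_apply[OF b3],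
       simp_all add: simps)
  have b1: "bounded_linear (\<lambda>X. Blinfun (\<lambda>Y. Blinfun (\<lambda>Z. S (inv T X) (inv T Y) (inv T Z))))"
    unfolding linear_conv_bounded_linear[symmetric]
    by (intro linearI; intro blinfun_eqI)
      (simp_all only: plus_blinfun.rep_eq scaleR_blinfun.rep_eq
        bounded_linear_Blinfun_apply[OF b3] bounded_linear_Blinfun_apply[OF b2],
       simp_all add: simps)
  show ?thesis
    by (simp add: tensor_act_def bounded_linear_Blinfun_apply b1 b2 b3)
qed

lemma orthonormal_basis_expand_of:
  assumes "orthonormal_basis_of W B" "x \<in> W"
  shows "x = (\<Sum>b\<in>B. (x \<bullet> b) *\<^sub>R b)"
proof -
  have B: "pairwise orthogonal B" "\<And>b. b \<in> B \<Longrightarrow> norm b = 1" "x \<in> span B"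
    using assms by (auto simp: orthonormal_basis_of_def)
  then have "0 \<notin> B" by force
  then have "finite B"
    using B(1) pairwise_orthogonal_independent independent_imp_finite by blast
  then show ?thesis
    using orthonormal_basis_expand[of B x] B by (simp add: inner_commute)
qed

lemma finite_orthonormal_basis_of:
  "orthonormal_basis_of W B \<Longrightarrow> finite (B :: 'a::euclidean_space set)"
  unfolding orthonormal_basis_of_def
  by (metis independent_imp_finite norm_zero pairwise_orthogonal_independent zero_neq_one)

lemma c23_eq:
  assumes B: "orthonormal_basis_of (dist_of \<xi>) B"
  shows "c23 \<xi> S X = (\<Sum>e\<in>B. S X e e)"
proof -
  define C where "C = (SOME B. orthonormal_basis_of (dist_of \<xi>) B)"
  have C: "orthonormal_basis_of (dist_of \<xi>) C"
    unfolding C_def using B by (rule someI)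
  have BD: "b \<in> dist_of \<xi>" if "b \<in> B" for b
    using B that span_base unfolding orthonormal_basis_of_def by blast
  have CD: "c \<in> dist_of \<xi>" if "c \<in> C" for c
    using C that span_base unfolding orthonormal_basis_of_def by blast
  note ex = orthonormal_basis_expand_of
  note simps = blinfun.sum_left blinfun.sum_right blinfun.scaleR_left blinfun.scaleR_right
  have "(\<Sum>c\<in>C. S X c c) = (\<Sum>c\<in>C. \<Sum>b\<in>B. (c \<bullet> b) * S X b c)"
  proof (rule sum.cong[OF refl])
    fix c assume "c \<in> C"
    have "S X c c = S X (\<Sum>b\<in>B. (c \<bullet> b) *\<^sub>R b) c" using ex[OF B CD[OF \<open>c \<in> C\<close>]] by simp
    then show "S X c c = (\<Sum>b\<in>B. (c \<bullet> b) * S X b c)" by (simp add: simps)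
  qed
  also have "\<dots> = (\<Sum>b\<in>B. \<Sum>c\<in>C. (c \<bullet> b) * S X b c)" by (rule sum.swap)
  also have "\<dots> = (\<Sum>b\<in>B. S X b b)"
  proof (rule sum.cong[OF refl])
    fix b assume "b \<in> B"
    have "S X b b = S X b (\<Sum>c\<in>C. (b \<bullet> c) *\<^sub>R c)" using ex[OF C BD[OF \<open>b \<in> B\<close>]] by simp
    then show "(\<Sum>c\<in>C. (c \<bullet> b) * S X b c) = S X b b" by (simp add: simps inner_commute)
  qed
  finally show ?thesis by (simp add: c23_def C_def)
qed

lemma ex_orthonormal_basis_of:
  "\<exists>B. orthonormal_basis_of (dist_of (\<xi> :: 'a::euclidean_space)) B"
proof -
  have "subspace (dist_of \<xi>)" by (simp add: dist_of_def subspace_orthogonal_comp)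
  then show ?thesis
    unfolding orthonormal_basis_of_def by (metis orthonormal_basis_subspace)
qed

end

theory Submission
  imports Defs
begin

text \<open>
  By the first-slot condition a tensor \<open>S\<close> in \<open>U\<^sup>* \<otimes> D\<^sup>* \<otimes> D\<^sup>*\<close> is the same thing as the bilinear form
  \<open>S \<xi>\<close> on \<open>D\<close>, and the decomposition is the splitting of a bilinear form into a multiple of the metric,
  a traceless symmetric form and a skew form (\<open>ZV_decomposition\<close>, \<open>ZV_direct\<close>).  Invariance of the
  summands is clear, since elements of \<open>SO(D)\<close> preserve the metric, and hence the trace.

  Irreducibility is proved with matrix entries in an orthonormal frame of \<open>D\<close>, using only rotations of
  the planes spanned by two frame vectors.  A submodule \<open>N\<close> contains, with each tensor, all linear
  combinations of its rotated copies; suitable combinations are projections that delete most entries.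

  For traceless symmetric forms, a combination of the four quarter turns in a plane projects to the
  traceless symmetric forms on that plane (\<open>planar_projection\<close>).  The result is nonzero for some plane,
  and the eighth turn extracts from it both the product form of the pair and the difference of the two
  squares (\<open>planar_split\<close>).  For skew forms, half turns give projections that keep the entries with
  exactly one index in a chosen pair (\<open>mixed_projection\<close>).  Combining them isolates a single entry,
  unless \<open>D\<close> has dimension \<open>4\<close>, where an entry cannot be separated from its Hodge dual (\<open>Z3_sub\<close>).  In
  both cases quarter turns move the resulting generator to all the other pairs of frame vectors
  (\<open>pair_tensor_connected\<close>), and the generators span the module.

  All plane rotations lie in \<open>SO(D)\<close> because each of them is the square of an orthogonal map
  (\<open>square_mem_SO_D\<close>).
\<close>

section \<open>Determinants of orthogonal maps\<close>

text \<open>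
  With the finite set \<open>Basis\<close> turned into a type of indices, \<^const>\<open>lin_det\<close> is the determinant of a
  matrix, so that the product formula for determinants carries over to it.
\<close>

typedef (overloaded) 'a basis_index = "Basis :: 'a::euclidean_space set"
  by (rule ex_in_conv[THEN iffD2]) simp

lemma bij_basis_index: "bij_betw Rep_basis_index UNIV (Basis :: 'a::euclidean_space set)"
  by (simp add: bij_betw_def inj_on_def Rep_basis_index_inject
      type_definition.Rep_range[OF type_definition_basis_index])

instance basis_index :: (euclidean_space) finite
  by standard (simp add: bij_betw_finite[OF bij_basis_index])

definition basis_matrix :: "('a::euclidean_space \<Rightarrow> 'a) \<Rightarrow> real ^ 'a basis_index ^ 'a basis_index"
  where "basis_matrix f = (\<chi> i j. f (Rep_basis_index j) \<bullet> Rep_basis_index i)"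

lemma lin_det_eq_det_basis_matrix:
  fixes f :: "'a::euclidean_space \<Rightarrow> 'a"
  shows "lin_det f = det (basis_matrix f)"
proof -
  let ?a = "Rep_basis_index :: 'a basis_index \<Rightarrow> 'a"
  have bij: "bij_betw ?a UNIV (Basis :: 'a set)" by (rule bij_basis_index)
  then have inj: "inj ?a" and B: "(Basis :: 'a set) = range ?a"
    by (auto simp: bij_betw_def)
  let ?m = "map_permutation UNIV ?a"
  have "?m = (\<lambda>p x. if x \<in> (Basis :: 'a set) then ?a (p (inv_into UNIV ?a x)) else x)"
    by (simp add: fun_eq_iff map_permutation_def restrict_id_def B)
  with bij_betw_permutations[OF bij]
  have bijp: "bij_betw ?m {p. p permutes UNIV} {p. p permutes (Basis :: 'a set)}" by simp
  have "lin_det f = (\<Sum>p | p permutes (UNIV :: 'a basis_index set).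
      of_int (sign (?m p)) * (\<Prod>b\<in>Basis. f b \<bullet> ?m p b))"
    unfolding lin_det_def by (rule sum.reindex_bij_betw[OF bijp, symmetric])
  also have "\<dots> = (\<Sum>p | p permutes (UNIV :: 'a basis_index set).
      of_int (sign p) * (\<Prod>i\<in>UNIV. transpose (basis_matrix f) $ i $ p i))"
  proof (rule sum.cong[OF refl])
    fix p :: "'a basis_index \<Rightarrow> 'a basis_index" assume "p \<in> {p. p permutes UNIV}"
    then have p: "p permutes UNIV" by simp
    have "sign (?m p) = sign p"
      using inj p by (intro sign_map_permutation) auto
    moreover have "(\<Prod>b\<in>Basis. f b \<bullet> ?m p b) = (\<Prod>i\<in>UNIV. f (?a i) \<bullet> ?m p (?a i))"
      by (rule prod.reindex_bij_betw[OF bij, symmetric])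
    ultimately show "of_int (sign (?m p)) * (\<Prod>b\<in>Basis. f b \<bullet> ?m p b) =
      of_int (sign p) * (\<Prod>i\<in>UNIV. transpose (basis_matrix f) $ i $ p i)"
      by (simp add: map_permutation_apply[OF inj UNIV_I] transpose_def basis_matrix_def)
  qed
  also have "\<dots> = det (transpose (basis_matrix f))" by (simp add: det_def)
  finally show ?thesis by simp
qed

lemma basis_matrix_apply:
  assumes "linear f"
  shows "f x \<bullet> Rep_basis_index i = (\<Sum>j\<in>UNIV. basis_matrix f $ i $ j * (x \<bullet> Rep_basis_index j))"
proof -
  note bij = bij_basis_index
  have "f x = f (\<Sum>b\<in>Basis. (x \<bullet> b) *\<^sub>R b)" by (simp add: euclidean_representation)
  also have "\<dots> = (\<Sum>b\<in>Basis. (x \<bullet> b) *\<^sub>R f b)"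
    using assms by (simp add: linear_sum linear_scale)
  also have "\<dots> = (\<Sum>j\<in>UNIV. (x \<bullet> Rep_basis_index j) *\<^sub>R f (Rep_basis_index j))"
    by (rule sum.reindex_bij_betw[OF bij, symmetric])
  finally show ?thesis
    by (simp add: inner_sum_left basis_matrix_def mult.commute)
qed

lemma lin_det_comp:
  assumes "linear f"
  shows "lin_det (f \<circ> g) = lin_det f * lin_det g"
proof -
  have "basis_matrix (f \<circ> g) = basis_matrix f ** basis_matrix g"
    by (simp add: vec_eq_iff matrix_matrix_mult_def basis_matrix_apply[OF assms]
        basis_matrix_def[of "f \<circ> g"])
       (simp add: basis_matrix_def)
  then show ?thesis by (simp add: lin_det_eq_det_basis_matrix det_mul)
qed

text \<open>
  The columns of the matrix are the images of the basis vectors, hence orthonormal.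
\<close>

lemma lin_det_orthogonal:
  assumes "orthogonal_transformation f"
  shows "lin_det f = 1 \<or> lin_det f = -1"
proof -
  let ?m = "basis_matrix f"
  have lin: "linear f" and iso: "\<And>x y. f x \<bullet> f y = x \<bullet> y"
    using assms by (auto simp: orthogonal_transformation_def)
  note bij = bij_basis_index
  have "transpose ?m ** ?m = mat 1"
  proof -
    have "(\<Sum>k\<in>UNIV. ?m $ k $ i * ?m $ k $ j) = (if i = j then 1 else 0)" for i j
    proof -
      have "(\<Sum>k\<in>UNIV. ?m $ k $ i * ?m $ k $ j) = (\<Sum>b\<in>Basis. (f (Rep_basis_index i) \<bullet> b) * (f (Rep_basis_index j) \<bullet> b))"
        unfolding basis_matrix_def
        by (simp add: sum.reindex_bij_betw[OF bij, where g = "\<lambda>b. (f (Rep_basis_index i) \<bullet> b) * (f (Rep_basis_index j) \<bullet> b)"])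
      also have "\<dots> = f (Rep_basis_index i) \<bullet> f (Rep_basis_index j)"
        by (simp add: euclidean_inner[symmetric])
      finally show ?thesis
        by (simp add: iso inner_Basis Rep_basis_index Rep_basis_index_inject)
    qed
    then show ?thesis by (simp add: vec_eq_iff matrix_matrix_mult_def transpose_def mat_def)
  qed
  then have "orthogonal_matrix ?m" by (simp add: orthogonal_matrix)
  then show ?thesis using det_orthogonal_matrix by (simp add: lin_det_eq_det_basis_matrix)
qed

text \<open>
  The determinant of an orthogonal map is a sign, so the determinant of its square is \<open>1\<close>.  Since
  every rotation of a plane is the square of the rotation by half the angle, this yields all the
  elements of \<open>SO(D)\<close> that the proof needs, with no computation of a determinant.
\<close>

lemma square_mem_SO_D:
  assumes "orthogonal_transformation T" "T \<xi> = \<xi>"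
  shows "T \<circ> T \<in> SO_D \<xi>"
  using assms lin_det_orthogonal[OF assms(1)]
  by (auto simp: SO_D_def lin_det_comp orthogonal_transformation_linear
      intro: orthogonal_transformation_compose)

section \<open>Plane rotations\<close>

text \<open>
  For orthonormal \<open>u\<close> and \<open>v\<close> this is the rotation of the plane spanned by \<open>u\<close> and \<open>v\<close>, from \<open>u\<close>
  towards \<open>v\<close>, with cosine \<open>c\<close> and sine \<open>s\<close>; it fixes the orthogonal complement of the plane.
\<close>

definition rot :: "'a::euclidean_space \<Rightarrow> 'a \<Rightarrow> real \<Rightarrow> real \<Rightarrow> 'a \<Rightarrow> 'a"
  where "rot u v c s x =
    x + ((c - 1) * (x \<bullet> u) - s * (x \<bullet> v)) *\<^sub>R u + ((c - 1) * (x \<bullet> v) + s * (x \<bullet> u)) *\<^sub>R v"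

lemma rot_comp:
  assumes "norm u = 1" "norm v = 1" "u \<bullet> v = 0"
  shows "rot u v c s (rot u v c' s' x) = rot u v (c * c' - s * s') (c * s' + s * c') x"
proof -
  have *: "u \<bullet> u = 1" "v \<bullet> v = 1" "v \<bullet> u = 0"
    using assms by (simp_all add: norm_eq_1 inner_commute)
  have u: "rot u v c' s' x \<bullet> u = c' * (x \<bullet> u) - s' * (x \<bullet> v)"
    and v: "rot u v c' s' x \<bullet> v = c' * (x \<bullet> v) + s' * (x \<bullet> u)"
    using assms(3) by (simp_all add: rot_def inner_add_left * algebra_simps)
  show ?thesis
    unfolding rot_def[of u v c s] u v
    by (simp add: rot_def algebra_simps)
qed

lemma rot_1_0 [simp]: "rot u v 1 0 x = x"
  by (simp add: rot_def)

lemma orthogonal_transformation_rot: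
  assumes "norm u = 1" "norm v = 1" "u \<bullet> v = 0" "c\<^sup>2 + s\<^sup>2 = 1"
  shows "orthogonal_transformation (rot u v c s)"
proof -
  have *: "u \<bullet> u = 1" "v \<bullet> v = 1" "v \<bullet> u = 0"
    using assms by (simp_all add: norm_eq_1 inner_commute)
  have "linear (rot u v c s)"
    by (intro linearI) (simp_all add: rot_def inner_add_left algebra_simps)
  moreover have "rot u v c s x \<bullet> rot u v c s y = x \<bullet> y" for x y
  proof -
    have "rot u v c s x \<bullet> rot u v c s y = x \<bullet> y +
        ((c\<^sup>2 + s\<^sup>2 - 1) * ((x \<bullet> u) * (y \<bullet> u) + (x \<bullet> v) * (y \<bullet> v)))"
      using assms(3)
      by (simp add: rot_def inner_add_left inner_add_right * inner_commute[of u y] inner_commute[of v y])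
         (simp add: algebra_simps power2_eq_square)
    then show ?thesis using assms(4) by simp
  qed
  ultimately show ?thesis by (simp add: orthogonal_transformation_def)
qed

lemma rot_mem_SO_D:
  assumes "norm u = 1" "norm v = 1" "u \<bullet> v = 0" "u \<bullet> \<xi> = 0" "v \<bullet> \<xi> = 0" "c\<^sup>2 + s\<^sup>2 = 1"
  shows "rot u v c s \<in> SO_D \<xi>"
proof -
  obtain t where t: "c = cos t" "s = sin t"
    using sincos_total_2pi[OF assms(6)] by metis
  let ?h = "rot u v (cos (t / 2)) (sin (t / 2))"
  have "?h \<circ> ?h = rot u v c s"
    using assms(1-3) t cos_double[of "t / 2"] sin_double[of "t / 2"]
    by (simp add: fun_eq_iff rot_comp power2_eq_square mult_ac)
  moreover have "?h \<circ> ?h \<in> SO_D \<xi>"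
    using assms by (intro square_mem_SO_D orthogonal_transformation_rot)
      (simp_all add: rot_def inner_commute)
  ultimately show ?thesis by simp
qed

lemma inv_rot:
  assumes "norm u = 1" "norm v = 1" "u \<bullet> v = 0" "c\<^sup>2 + s\<^sup>2 = 1"
  shows "inv (rot u v c s) = rot u v c (- s)"
  using assms
  by (intro inv_unique_comp) (simp_all add: fun_eq_iff rot_comp power2_eq_square)

section \<open>Tensors in an adapted frame\<close>

lemma mem_dist_of: "x \<in> dist_of \<xi> \<longleftrightarrow> x \<bullet> \<xi> = 0"
  by (auto simp: dist_of_def line_of_def orthogonal_comp_def orthogonal_def span_singleton inner_commute)

lemma mem_line_of: "x \<in> line_of \<xi> \<longleftrightarrow> (\<exists>c. x = c *\<^sub>R \<xi>)"
  by (auto simp: line_of_def span_singleton)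

definition elem_tensor :: "'a::euclidean_space \<Rightarrow> 'a \<Rightarrow> 'a \<Rightarrow> 'a trilinear"
  where "elem_tensor \<xi> a b = blinfun_scaleR_left
    (blinfun_scaleR_left (blinfun_inner_left b) o\<^sub>L blinfun_inner_left a) o\<^sub>L blinfun_inner_left \<xi>"

lemma elem_tensor_apply: "elem_tensor \<xi> a b X Y Z = (X \<bullet> \<xi>) * (Y \<bullet> a) * (Z \<bullet> b)"
  by (simp add: elem_tensor_def blinfun.scaleR_left inner_commute)

text \<open>
  All three modules are described by the entries \<open>S \<xi> a b\<close> for \<open>a\<close> and \<open>b\<close> in one fixed
  orthonormal basis of \<open>D\<close>.
\<close>

locale adapted_frame =
  fixes \<xi> :: "'a::euclidean_space" and B :: "'a set"
  assumes unit: "norm \<xi> = 1"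
    and frame: "orthonormal_basis_of (dist_of \<xi>) B"
begin

lemma finite_frame [simp]: "finite B"
  using frame by (rule finite_orthonormal_basis_of)

lemma frame_mem: "a \<in> B \<Longrightarrow> a \<in> dist_of \<xi>"
  using frame span_base unfolding orthonormal_basis_of_def by blast

lemma unit_inner [simp]: "\<xi> \<bullet> \<xi> = 1"
  using unit by (simp add: norm_eq_1)

lemma frame_perp [simp]:
  assumes "a \<in> B"
  shows "a \<bullet> \<xi> = 0" "\<xi> \<bullet> a = 0"
  using frame_mem[OF assms] by (simp_all add: mem_dist_of inner_commute)

lemma frame_norm: "a \<in> B \<Longrightarrow> norm a = 1"
  using frame by (auto simp: orthonormal_basis_of_def)

lemma frame_inner: "a \<in> B \<Longrightarrow> b \<in> B \<Longrightarrow> a \<bullet> b = (if a = b then 1 else 0)"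
  using frame frame_norm
  by (auto simp: orthonormal_basis_of_def pairwise_def orthogonal_def norm_eq_1)

lemma card_frame: "card B + 1 = DIM('a)"
proof -
  have "0 \<notin> B" using frame_norm by force
  then have "independent B"
    using frame by (auto simp: orthonormal_basis_of_def pairwise_orthogonal_independent)
  moreover have "span B = dist_of \<xi>"
    using frame by (simp add: orthonormal_basis_of_def)
  ultimately have "card B = dim (dist_of \<xi>)"
    by (metis dim_eq_card_independent dim_span)
  also have "dist_of \<xi> = {x. \<xi> \<bullet> x = 0}"
    by (auto simp: mem_dist_of inner_commute)
  also have "dim \<dots> = DIM('a) - 1"
    using unit by (intro dim_hyperplane) auto
  finally show ?thesis
    using DIM_positive[where 'a = 'a] by linarith
qed

text \<open>
  Membership in \<open>U\<^sup>* \<otimes> D\<^sup>* \<otimes> D\<^sup>*\<close> in terms of \<open>\<xi>\<close> alone: split each argument into its components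
  along \<open>\<xi>\<close> and in \<open>D\<close>.
\<close>

lemma ZV_iff:
  "S \<in> ZV \<xi> \<longleftrightarrow> (\<forall>X Y Z. S X Y Z = (X \<bullet> \<xi>) * S \<xi> Y Z) \<and> (\<forall>X Y. S X Y \<xi> = 0) \<and> (\<forall>X Z. S X \<xi> Z = 0)"
    (is "_ \<longleftrightarrow> ?R")
proof
  assume S: "S \<in> ZV \<xi>"
  have "S X Y Z = (X \<bullet> \<xi>) * S \<xi> Y Z" for X Y Z
  proof -
    have "S (X - (X \<bullet> \<xi>) *\<^sub>R \<xi>) Y Z = 0"
      using S by (simp add: ZV_def mem_dist_of inner_diff_left)
    then show ?thesis
      by (simp add: blinfun.diff_left blinfun.diff_right blinfun.scaleR_left blinfun.scaleR_right)
  qed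
  moreover have "S X Y \<xi> = 0" "S X \<xi> Z = 0" for X Y Z
    using S by (simp_all add: ZV_def line_of_def span_base)
  ultimately show ?R by (intro conjI allI)
next
  assume R: ?R
  have "S X Y Z = 0" if "X \<in> dist_of \<xi>" for X Y Z
    using R[THEN conjunct1, rule_format, of X Y Z] that by (simp add: mem_dist_of)
  moreover have "S X Y \<xi> = 0" "S X \<xi> Z = 0" for X Y Z
    by (rule R[THEN conjunct2, THEN conjunct1, rule_format]
        R[THEN conjunct2, THEN conjunct2, rule_format])+
  ultimately show "S \<in> ZV \<xi>"
    by (auto simp: ZV_def mem_line_of blinfun.scaleR_left blinfun.scaleR_right)
qed

lemma
  assumes "S \<in> ZV \<xi>"
  shows ZV_factor: "S X Y Z = (X \<bullet> \<xi>) * S \<xi> Y Z"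
    and ZV_xi: "S X Y \<xi> = 0" "S X \<xi> Z = 0"
  by (rule iffD1[OF ZV_iff assms, THEN conjunct1, rule_format]
      iffD1[OF ZV_iff assms, THEN conjunct2, THEN conjunct1, rule_format]
      iffD1[OF ZV_iff assms, THEN conjunct2, THEN conjunct2, rule_format])+

lemma ZV_expand:
  assumes "S \<in> ZV \<xi>"
  shows "S = (\<Sum>a\<in>B. \<Sum>b\<in>B. S \<xi> a b *\<^sub>R elem_tensor \<xi> a b)"
proof (intro blinfun_eqI)
  fix X Y Z
  have S: "\<And>X Y Z. S X Y Z = (X \<bullet> \<xi>) * S \<xi> Y Z" "\<And>X Y. S X Y \<xi> = 0" "\<And>X Z. S X \<xi> Z = 0"
    by (rule ZV_factor[OF assms] ZV_xi[OF assms])+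
  note simps = blinfun.add_left blinfun.add_right blinfun.scaleR_left blinfun.scaleR_right
    blinfun.sum_left blinfun.sum_right
  have ex: "(W \<bullet> \<xi>) *\<^sub>R \<xi> + (\<Sum>b\<in>B. (W \<bullet> b) *\<^sub>R b) = W" for W
  proof -
    have "W - (W \<bullet> \<xi>) *\<^sub>R \<xi> = (\<Sum>b\<in>B. ((W - (W \<bullet> \<xi>) *\<^sub>R \<xi>) \<bullet> b) *\<^sub>R b)"
      by (intro orthonormal_basis_expand_of[OF frame]) (simp add: mem_dist_of inner_diff_left)
    also have "\<dots> = (\<Sum>b\<in>B. (W \<bullet> b) *\<^sub>R b)"
      by (intro sum.cong) (simp_all add: inner_diff_left)
    finally show ?thesis by (metis add.commute diff_eq_eq)
  qed
  have left: "S \<xi> ((Y \<bullet> \<xi>) *\<^sub>R \<xi> + (\<Sum>a\<in>B. (Y \<bullet> a) *\<^sub>R a)) W = (\<Sum>a\<in>B. (Y \<bullet> a) * S \<xi> a W)" for W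
    by (simp add: simps S(2,3))
  have "S \<xi> Y Z = S \<xi> ((Y \<bullet> \<xi>) *\<^sub>R \<xi> + (\<Sum>a\<in>B. (Y \<bullet> a) *\<^sub>R a)) ((Z \<bullet> \<xi>) *\<^sub>R \<xi> + (\<Sum>b\<in>B. (Z \<bullet> b) *\<^sub>R b))"
    by (simp only: ex)
  also have "\<dots> = (\<Sum>a\<in>B. (Y \<bullet> a) * S \<xi> a ((Z \<bullet> \<xi>) *\<^sub>R \<xi> + (\<Sum>b\<in>B. (Z \<bullet> b) *\<^sub>R b)))"
    by (rule left)
  also have "\<dots> = (\<Sum>a\<in>B. (Y \<bullet> a) * (\<Sum>b\<in>B. (Z \<bullet> b) * S \<xi> a b))"
    by (simp add: simps S(2))
  finally have "S X Y Z = (X \<bullet> \<xi>) * (\<Sum>a\<in>B. (Y \<bullet> a) * (\<Sum>b\<in>B. (Z \<bullet> b) * S \<xi> a b))"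
    using S(1)[of X Y Z] by metis
  also have "\<dots> = (\<Sum>a\<in>B. \<Sum>b\<in>B. S \<xi> a b * elem_tensor \<xi> a b X Y Z)"
    unfolding elem_tensor_apply sum_distrib_left by (intro sum.cong refl) (simp add: mult_ac)
  finally show "S X Y Z = (\<Sum>a\<in>B. \<Sum>b\<in>B. S \<xi> a b *\<^sub>R elem_tensor \<xi> a b) X Y Z"
    by (simp add: blinfun.scaleR_left blinfun.sum_left)
qed

lemma ZV_eqI:
  assumes "S \<in> ZV \<xi>" "S' \<in> ZV \<xi>" "\<And>a b. a \<in> B \<Longrightarrow> b \<in> B \<Longrightarrow> S \<xi> a b = S' \<xi> a b"
  shows "S = S'"
proof -
  have "S = (\<Sum>a\<in>B. \<Sum>b\<in>B. S \<xi> a b *\<^sub>R elem_tensor \<xi> a b)" by (rule ZV_expand) fact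
  also have "\<dots> = (\<Sum>a\<in>B. \<Sum>b\<in>B. S' \<xi> a b *\<^sub>R elem_tensor \<xi> a b)"
    by (intro sum.cong) (simp_all add: assms)
  also have "\<dots> = S'" by (rule ZV_expand[symmetric]) fact
  finally show ?thesis .
qed

lemma elem_tensor_mem_ZV: "a \<in> B \<Longrightarrow> b \<in> B \<Longrightarrow> elem_tensor \<xi> a b \<in> ZV \<xi>"
  by (simp add: ZV_iff elem_tensor_apply)

lemma subspace_ZV: "subspace (ZV \<xi>)"
  by (auto simp: subspace_def ZV_def blinfun.add_left blinfun.scaleR_left)

text \<open>
  Both symmetry (\<open>\<epsilon> = 1\<close>) and skew-symmetry (\<open>\<epsilon> = -1\<close>) on \<open>D\<close> extend to all arguments, because
  the tensor vanishes when one of its last two arguments is \<open>\<xi>\<close>.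
\<close>

lemma flip_eigen_iff:
  assumes S: "S \<in> ZV \<xi>"
  shows "(\<forall>Y\<in>dist_of \<xi>. \<forall>Z\<in>dist_of \<xi>. S \<xi> Y Z = \<epsilon> * S \<xi> Z Y) \<longleftrightarrow> (\<forall>X Y Z. S X Y Z = \<epsilon> * S X Z Y)"
    (is "?L \<longleftrightarrow> ?R")
proof
  assume L: ?L
  show ?R
  proof (intro allI)
    fix X Y Z
    let ?p = "\<lambda>W. W - (W \<bullet> \<xi>) *\<^sub>R \<xi>"
    have "?p W \<in> dist_of \<xi>" for W by (simp add: mem_dist_of inner_diff_left)
    then have "S \<xi> (?p Y) (?p Z) = \<epsilon> * S \<xi> (?p Z) (?p Y)" by (intro L[rule_format])
    then have "S \<xi> Y Z = \<epsilon> * S \<xi> Z Y"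
      by (simp add: ZV_xi[OF S] blinfun.diff_left blinfun.diff_right blinfun.scaleR_left blinfun.scaleR_right)
    then show "S X Y Z = \<epsilon> * S X Z Y"
      by (simp add: ZV_factor[OF S, of X Y Z] ZV_factor[OF S, of X Z Y])
  qed
next
  assume R: ?R
  then show ?L by (intro ballI R[rule_format])
qed

lemma Z2_iff: "S \<in> Z2 \<xi> \<longleftrightarrow>
    S \<in> ZV \<xi> \<and> (\<forall>X Y Z. S X Y Z = S X Z Y) \<and> (\<Sum>e\<in>B. S \<xi> e e) = 0"
proof (cases "S \<in> ZV \<xi>")
  case True
  have factor: "(\<forall>X. \<forall>Y\<in>dist_of \<xi>. \<forall>Z\<in>dist_of \<xi>. S X Y Z = (X \<bullet> \<xi>) * S \<xi> Y Z) = True"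
    by (intro eqTrueI allI ballI ZV_factor True)
  have "c23 \<xi> S X = (X \<bullet> \<xi>) * (\<Sum>e\<in>B. S \<xi> e e)" for X
    unfolding c23_eq[OF frame] sum_distrib_left by (intro sum.cong refl ZV_factor True)
  then have trace: "(\<forall>X. c23 \<xi> S X = 0) = ((\<Sum>e\<in>B. S \<xi> e e) = 0)"
    by (metis mult_zero_right mult_1 unit_inner)
  show ?thesis
    by (simp only: Z2_def mem_Collect_eq True factor trace
        flip_eigen_iff[OF True, of 1, unfolded mult_1] simp_thms)
qed (simp add: Z2_def)

lemma Z3_iff: "S \<in> Z3 \<xi> \<longleftrightarrow> S \<in> ZV \<xi> \<and> (\<forall>X Y Z. S X Y Z = - S X Z Y)"
proof (cases "S \<in> ZV \<xi>")
  case True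
  have factor: "(\<forall>X. \<forall>Y\<in>dist_of \<xi>. \<forall>Z\<in>dist_of \<xi>. S X Y Z = (X \<bullet> \<xi>) * S \<xi> Y Z) = True"
    by (intro eqTrueI allI ballI ZV_factor True)
  show ?thesis
    by (simp only: Z3_def mem_Collect_eq True factor
        flip_eigen_iff[OF True, of "-1", unfolded mult_minus1] simp_thms)
qed (simp add: Z3_def)

definition metric_tensor :: "'a trilinear"
  where "metric_tensor = (\<Sum>a\<in>B. elem_tensor \<xi> a a)"

lemma metric_tensor_mem_ZV: "metric_tensor \<in> ZV \<xi>"
  unfolding metric_tensor_def by (intro subspace_sum subspace_ZV elem_tensor_mem_ZV)

lemma metric_tensor_apply:
  assumes "Y \<in> dist_of \<xi>"
  shows "metric_tensor X Y Z = (X \<bullet> \<xi>) * (Y \<bullet> Z)"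
proof -
  have "Y \<bullet> Z = (\<Sum>b\<in>B. (Y \<bullet> b) *\<^sub>R b) \<bullet> Z"
    using orthonormal_basis_expand_of[OF frame assms] by simp
  then show ?thesis
    by (simp add: metric_tensor_def blinfun.sum_left elem_tensor_apply inner_sum_left
        inner_commute[of Z] sum_distrib_left mult_ac)
qed

lemma metric_tensor_frame:
  "a \<in> B \<Longrightarrow> b \<in> B \<Longrightarrow> metric_tensor \<xi> a b = (if a = b then 1 else 0)"
  by (simp add: metric_tensor_apply frame_mem frame_inner)

lemma Z1_eq: "Z1 \<xi> = span {metric_tensor}"
proof -
  have "S = c *\<^sub>R metric_tensor" if "S \<in> ZV \<xi>"
    "\<forall>X. \<forall>Y\<in>dist_of \<xi>. \<forall>Z\<in>dist_of \<xi>. S X Y Z = c * (Y \<bullet> Z) * (X \<bullet> \<xi>)" for S c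
    using that subspace_scale[OF subspace_ZV metric_tensor_mem_ZV]
    by (intro ZV_eqI) (simp_all add: frame_mem metric_tensor_frame blinfun.scaleR_left frame_inner)
  moreover have "c *\<^sub>R metric_tensor \<in> Z1 \<xi>" for c
    using subspace_scale[OF subspace_ZV metric_tensor_mem_ZV]
    by (auto simp: Z1_def metric_tensor_apply blinfun.scaleR_left)
  ultimately show ?thesis
    by (auto simp: span_singleton Z1_def)
qed

lemma subspace_Z1: "subspace (Z1 \<xi>)"
  by (simp add: Z1_eq)

lemma subspace_flip_eigen: "subspace {S :: 'a trilinear. \<forall>X Y Z. S X Y Z = \<epsilon> * S X Z Y}"
proof (rule subspaceI; clarify)
  fix S S' :: "'a trilinear" and c X Y Z
  assume S: "\<forall>X Y Z. S X Y Z = \<epsilon> * S X Z Y"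
  have *: "S X Y Z = \<epsilon> * S X Z Y" by (rule S[rule_format])
  from * show "(c *\<^sub>R S) X Y Z = \<epsilon> * (c *\<^sub>R S) X Z Y"
    by (simp add: blinfun.scaleR_left)
  assume S': "\<forall>X Y Z. S' X Y Z = \<epsilon> * S' X Z Y"
  have "S' X Y Z = \<epsilon> * S' X Z Y" by (rule S'[rule_format])
  with * show "(S + S') X Y Z = \<epsilon> * (S + S') X Z Y"
    by (simp add: blinfun.add_left distrib_left)
qed simp

lemma subspace_Z2: "subspace (Z2 \<xi>)"
proof -
  have "subspace {S :: 'a trilinear. (\<Sum>e\<in>B. S \<xi> e e) = 0}"
    by (rule subspaceI)
      (simp_all add: blinfun.add_left blinfun.scaleR_left sum.distrib flip: sum_distrib_left)
  from subspace_inter[OF subspace_ZV subspace_inter[OF subspace_flip_eigen[of 1] this]]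
  show ?thesis by (rule back_subst[of subspace]) (simp add: set_eq_iff Z2_iff)
qed

lemma subspace_Z3: "subspace (Z3 \<xi>)"
proof -
  from subspace_inter[OF subspace_ZV subspace_flip_eigen[of "-1"]]
  show ?thesis by (rule back_subst[of subspace]) (simp add: set_eq_iff Z3_iff)
qed

section \<open>Invariance and the direct sum decomposition\<close>

lemma SO_D_inv:
  assumes "T \<in> SO_D \<xi>"
  shows "orthogonal_transformation (inv T)" "inv T \<xi> = \<xi>" "inv T X \<bullet> inv T Y = X \<bullet> Y"
    "tensor_act T S X Y Z = S (inv T X) (inv T Y) (inv T Z)"
proof -
  have T: "orthogonal_transformation T" "T \<xi> = \<xi>" using assms by (auto simp: SO_D_def)
  then show orth: "orthogonal_transformation (inv T)" by (simp add: orthogonal_transformation_inv)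
  show "inv T \<xi> = \<xi>"
    using T by (metis inv_f_f orthogonal_transformation_inj)
  show "inv T X \<bullet> inv T Y = X \<bullet> Y" using orth by (simp add: orthogonal_transformation_def)
  show "tensor_act T S X Y Z = S (inv T X) (inv T Y) (inv T Z)" using T(1) by (rule tensor_act_apply)
qed

lemma SO_D_inv_inner_xi: "T \<in> SO_D \<xi> \<Longrightarrow> inv T X \<bullet> \<xi> = X \<bullet> \<xi>"
  by (metis SO_D_inv(2,3))

lemma SO_D_inv_dist: "T \<in> SO_D \<xi> \<Longrightarrow> inv T X \<in> dist_of \<xi> \<longleftrightarrow> X \<in> dist_of \<xi>"
  by (simp add: mem_dist_of SO_D_inv_inner_xi)

lemma tensor_act_ZV:
  assumes "T \<in> SO_D \<xi>" "S \<in> ZV \<xi>"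
  shows "tensor_act T S \<in> ZV \<xi>"
  unfolding ZV_iff SO_D_inv(2,4)[OF assms(1)]
  using ZV_factor[OF assms(2), of "inv T X" for X] SO_D_inv_inner_xi[OF assms(1)]
  by (intro conjI allI) (simp_all only: ZV_xi[OF assms(2)])

lemma Z_subsets_ZV: "Z1 \<xi> \<subseteq> ZV \<xi>" "Z2 \<xi> \<subseteq> ZV \<xi>" "Z3 \<xi> \<subseteq> ZV \<xi>"
  unfolding Z1_def Z2_def Z3_def by (rule Collect_restrict)+

lemma SO_submodule_ZV: "SO_submodule \<xi> (ZV \<xi>)"
  by (simp add: SO_submodule_def subspace_ZV tensor_act_ZV)

lemma SO_submodule_Z1: "SO_submodule \<xi> (Z1 \<xi>)"
  unfolding SO_submodule_def
proof (intro conjI ballI subspace_Z1)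
  fix T S assume T: "T \<in> SO_D \<xi>" and S: "S \<in> Z1 \<xi>"
  then obtain c where "\<And>X Y Z. Y \<in> dist_of \<xi> \<Longrightarrow> Z \<in> dist_of \<xi> \<Longrightarrow> S X Y Z = c * (Y \<bullet> Z) * (X \<bullet> \<xi>)"
    by (auto simp: Z1_def)
  then have "tensor_act T S X Y Z = c * (Y \<bullet> Z) * (X \<bullet> \<xi>)"
    if "Y \<in> dist_of \<xi>" "Z \<in> dist_of \<xi>" for X Y Z
    using that T by (simp add: SO_D_inv SO_D_inv_inner_xi SO_D_inv_dist)
  moreover have "tensor_act T S \<in> ZV \<xi>" using T S Z_subsets_ZV by (blast intro: tensor_act_ZV)
  ultimately show "tensor_act T S \<in> Z1 \<xi>" by (auto simp: Z1_def)
qed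

text \<open>
  The trace over \<open>D\<close> is independent of the orthonormal basis, so invariance of \<open>Z2\<close> under \<open>SO(D)\<close>
  only needs that an element of \<open>SO(D)\<close> carries the frame to another orthonormal basis of \<open>D\<close>.
\<close>

lemma frame_image:
  assumes "T \<in> SO_D \<xi>"
  shows "orthonormal_basis_of (dist_of \<xi>) (inv T ` B)"
  unfolding orthonormal_basis_of_def
proof (intro conjI)
  note T = SO_D_inv(1-3)[OF assms]
  show "pairwise orthogonal (inv T ` B)"
    using frame by (auto simp: orthonormal_basis_of_def pairwise_def orthogonal_def T)
  show "\<forall>e\<in>inv T ` B. norm e = 1"
    using frame_norm by (auto simp: orthogonal_transformation_norm[OF T(1)])
  have "inv T ` dist_of \<xi> = dist_of \<xi>"
  proof -
    have "x \<in> inv T ` dist_of \<xi>" if "x \<in> dist_of \<xi>" for x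
    proof -
      obtain y where "x = inv T y"
        using orthogonal_transformation_surj[OF T(1)] by (metis surjD)
      then show ?thesis using that SO_D_inv_dist[OF assms] by simp
    qed
    then show ?thesis using SO_D_inv_dist[OF assms] by auto
  qed
  then show "span (inv T ` B) = dist_of \<xi>"
    using frame span_linear_image[OF orthogonal_transformation_linear[OF T(1)], of B]
    by (simp add: orthonormal_basis_of_def)
qed

lemma SO_submodule_Z2: "SO_submodule \<xi> (Z2 \<xi>)"
  unfolding SO_submodule_def
proof (intro conjI ballI subspace_Z2)
  fix T S assume T: "T \<in> SO_D \<xi>" and S: "S \<in> Z2 \<xi>"
  note S' = S[unfolded Z2_iff, THEN conjunct2, THEN conjunct1, rule_format]
  have "inj_on (inv T) B"
    using orthogonal_transformation_inj[OF SO_D_inv(1)[OF T]] by (rule inj_on_subset) simp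
  then have "(\<Sum>e\<in>B. S \<xi> (inv T e) (inv T e)) = (\<Sum>e\<in>inv T ` B. S \<xi> e e)"
    by (simp add: sum.reindex)
  also have "\<dots> = (\<Sum>e\<in>B. S \<xi> e e)"
    using c23_eq[OF frame] c23_eq[OF frame_image[OF T]] by metis
  also have "\<dots> = 0" using S by (simp add: Z2_iff)
  finally have "(\<Sum>e\<in>B. tensor_act T S \<xi> e e) = 0" by (simp add: SO_D_inv[OF T])
  moreover have "tensor_act T S X Y Z = tensor_act T S X Z Y" for X Y Z
    unfolding SO_D_inv(4)[OF T] by (rule S')
  moreover have "tensor_act T S \<in> ZV \<xi>" using T S Z_subsets_ZV by (blast intro: tensor_act_ZV)
  ultimately show "tensor_act T S \<in> Z2 \<xi>" unfolding Z2_iff by (intro conjI allI)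
qed

lemma SO_submodule_Z3: "SO_submodule \<xi> (Z3 \<xi>)"
  unfolding SO_submodule_def
proof (intro conjI ballI subspace_Z3)
  fix T S assume T: "T \<in> SO_D \<xi>" and S: "S \<in> Z3 \<xi>"
  note S' = S[unfolded Z3_iff, THEN conjunct2, rule_format]
  have "tensor_act T S X Y Z = - tensor_act T S X Z Y" for X Y Z
    unfolding SO_D_inv(4)[OF T] by (rule S')
  moreover have "tensor_act T S \<in> ZV \<xi>" using T S Z_subsets_ZV by (blast intro: tensor_act_ZV)
  ultimately show "tensor_act T S \<in> Z3 \<xi>" unfolding Z3_iff by (intro conjI allI)
qed

text \<open>
  With \<open>\<epsilon> = 1\<close> these tensors are symmetric and with \<open>\<epsilon> = -1\<close> they are skew in the last two
  arguments; the sign is a parameter because the arguments for \<open>Z2\<close> and \<open>Z3\<close> are largely the same.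
\<close>

definition pair_tensor :: "real \<Rightarrow> 'a \<Rightarrow> 'a \<Rightarrow> 'a trilinear"
  where "pair_tensor \<epsilon> a b = elem_tensor \<xi> a b + \<epsilon> *\<^sub>R elem_tensor \<xi> b a"

lemma pair_tensor_apply:
  "pair_tensor \<epsilon> a b X Y Z = (X \<bullet> \<xi>) * ((Y \<bullet> a) * (Z \<bullet> b) + \<epsilon> * ((Y \<bullet> b) * (Z \<bullet> a)))"
  by (simp add: pair_tensor_def blinfun.add_left blinfun.scaleR_left elem_tensor_apply algebra_simps)

lemma pair_tensor_mem_ZV: "a \<in> B \<Longrightarrow> b \<in> B \<Longrightarrow> pair_tensor \<epsilon> a b \<in> ZV \<xi>"
  by (simp add: pair_tensor_def subspace_add subspace_scale subspace_ZV elem_tensor_mem_ZV)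

text \<open>
  Average the expansion of \<open>S\<close> over the exchange of the two indices.
\<close>

lemma pair_expand:
  assumes "S \<in> ZV \<xi>" and flip: "\<And>X Y Z. S X Y Z = \<epsilon> * S X Z Y" and "\<epsilon> * \<epsilon> = 1"
  shows "S = (\<Sum>a\<in>B. \<Sum>b\<in>B. (S \<xi> a b / 2) *\<^sub>R pair_tensor \<epsilon> a b)"
proof -
  let ?E = "elem_tensor \<xi>"
  have "(\<Sum>a\<in>B. \<Sum>b\<in>B. (S \<xi> a b / 2) *\<^sub>R pair_tensor \<epsilon> a b) =
      (1 / 2) *\<^sub>R (\<Sum>a\<in>B. \<Sum>b\<in>B. S \<xi> a b *\<^sub>R ?E a b) +
      (1 / 2) *\<^sub>R (\<Sum>a\<in>B. \<Sum>b\<in>B. (\<epsilon> * S \<xi> a b) *\<^sub>R ?E b a)"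
    by (simp add: pair_tensor_def scaleR_add_right sum.distrib scaleR_sum_right mult_ac)
  also have "(\<Sum>a\<in>B. \<Sum>b\<in>B. (\<epsilon> * S \<xi> a b) *\<^sub>R ?E b a) = (\<Sum>a\<in>B. \<Sum>b\<in>B. S \<xi> a b *\<^sub>R ?E a b)"
    by (subst sum.swap) (simp only: flip[symmetric])
  finally show ?thesis
    by (simp flip: scaleR_add_left ZV_expand[OF assms(1)])
qed

lemma pair_tensor_mem_Z3:
  assumes "a \<in> B" "b \<in> B"
  shows "pair_tensor (-1) a b \<in> Z3 \<xi>"
  unfolding Z3_iff using pair_tensor_mem_ZV[OF assms]
  by (simp add: pair_tensor_apply algebra_simps)

text \<open>
  Split \<open>S\<close> into its symmetric part \<open>T\<close> and its skew part, and subtract from \<open>T\<close> the multiple of the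
  metric that has the same trace.
\<close>

lemma ZV_decomposition: "ZV \<xi> = Z1 \<xi> + Z2 \<xi> + Z3 \<xi>"
proof
  show "ZV \<xi> \<subseteq> Z1 \<xi> + Z2 \<xi> + Z3 \<xi>"
  proof
    fix S assume S: "S \<in> ZV \<xi>"
    define t where "t = (\<Sum>e\<in>B. S \<xi> e e) / card B"
    define S1 where "S1 = t *\<^sub>R metric_tensor"
    define S3 where "S3 = (\<Sum>a\<in>B. \<Sum>b\<in>B. (S \<xi> a b / 2) *\<^sub>R pair_tensor (-1) a b)"
    define T where "T = (\<Sum>a\<in>B. \<Sum>b\<in>B. (S \<xi> a b / 2) *\<^sub>R pair_tensor 1 a b)"
    have halves: "(r / 2) *\<^sub>R pair_tensor 1 a b + (r / 2) *\<^sub>R pair_tensor (-1) a b = r *\<^sub>R elem_tensor \<xi> a b" for r a b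
      by (intro blinfun_eqI)
        (simp add: blinfun.add_left blinfun.scaleR_left pair_tensor_apply elem_tensor_apply algebra_simps)
    have sum: "S = T + S3"
      unfolding T_def S3_def sum.distrib[symmetric] halves by (rule ZV_expand[OF S])
    have S1: "S1 \<in> Z1 \<xi>" by (simp add: S1_def Z1_eq span_base span_scale)
    have S3: "S3 \<in> Z3 \<xi>" unfolding S3_def
      by (intro subspace_sum subspace_scale subspace_Z3 pair_tensor_mem_Z3)
    have T_flip: "T X Y Z = T X Z Y" for X Y Z
    proof -
      have "T \<in> {S :: 'a trilinear. \<forall>X Y Z. S X Y Z = 1 * S X Z Y}"
        unfolding T_def
        by (intro subspace_sum subspace_scale subspace_flip_eigen) (simp add: pair_tensor_apply algebra_simps)
      then have *: "\<forall>X Y Z. T X Y Z = 1 * T X Z Y" by (rule CollectD)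
      show ?thesis using *[rule_format, of X Y Z] by (simp only: mult_1)
    qed
    have "T - S1 \<in> ZV \<xi>"
      unfolding T_def S1_def
      by (intro subspace_diff subspace_sum subspace_scale subspace_ZV pair_tensor_mem_ZV metric_tensor_mem_ZV)
    moreover have "(T - S1) X Y Z = (T - S1) X Z Y" for X Y Z
    proof -
      have "metric_tensor X Y Z = metric_tensor X Z Y"
        by (simp add: metric_tensor_def blinfun.sum_left elem_tensor_apply mult_ac)
      then show ?thesis
        unfolding S1_def blinfun.diff_left blinfun.scaleR_left T_flip[of X Y Z] by simp
    qed
    moreover have "(\<Sum>e\<in>B. (T - S1) \<xi> e e) = 0"
    proof -
      have "S3 \<xi> e e = 0" for e
        using S3[unfolded Z3_iff, THEN conjunct2, rule_format, of \<xi> e e] by simp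
      then have "T \<xi> e e = S \<xi> e e" for e
        by (simp add: sum blinfun.add_left)
      then have "(\<Sum>e\<in>B. (T - S1) \<xi> e e) = (\<Sum>e\<in>B. S \<xi> e e) - real (card B) * t"
        by (simp add: S1_def blinfun.diff_left blinfun.scaleR_left metric_tensor_frame sum_subtractf)
      \<comment> \<open>For an empty frame \<open>t\<close> is \<open>0\<close>, and both sums are empty.\<close>
      then show ?thesis by (cases "B = {}") (simp_all add: t_def)
    qed
    ultimately have S2: "T - S1 \<in> Z2 \<xi>" unfolding Z2_iff by (intro conjI allI)
    have "S = S1 + (T - S1) + S3" using sum by simp
    with S1 S2 S3 show "S \<in> Z1 \<xi> + Z2 \<xi> + Z3 \<xi>" by (metis set_plus_intro)
  qed
  show "Z1 \<xi> + Z2 \<xi> + Z3 \<xi> \<subseteq> ZV \<xi>"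
  proof
    fix S assume "S \<in> Z1 \<xi> + Z2 \<xi> + Z3 \<xi>"
    then obtain S1 S2 S3 where S: "S = S1 + S2 + S3" "S1 \<in> Z1 \<xi>" "S2 \<in> Z2 \<xi>" "S3 \<in> Z3 \<xi>"
      by (elim set_plus_elim) simp
    show "S \<in> ZV \<xi>"
      unfolding S(1) using S(2-) Z_subsets_ZV by (intro subspace_add subspace_ZV) blast+
  qed
qed

text \<open>
  Exchanging the last two arguments changes only the sign of \<open>S3\<close>, so \<open>S3\<close> vanishes; the trace then
  determines \<open>S1\<close>.
\<close>

lemma ZV_direct:
  assumes S1: "S1 \<in> Z1 \<xi>" and S2: "S2 \<in> Z2 \<xi>" and S3: "S3 \<in> Z3 \<xi>" and sum: "S1 + S2 + S3 = 0"
  shows "S1 = 0" "S2 = 0" "S3 = 0"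
proof -
  have ZV: "S1 \<in> ZV \<xi>" "S2 \<in> ZV \<xi>" "S3 \<in> ZV \<xi>" "0 \<in> ZV \<xi>"
    using S1 S2 S3 Z_subsets_ZV by (auto simp: subspace_0 subspace_ZV)
  obtain c where c: "S1 = c *\<^sub>R metric_tensor" using S1 by (auto simp: Z1_eq span_singleton)
  have coeff: "(if a = b then c else 0) + S2 \<xi> a b + S3 \<xi> a b = 0" if "a \<in> B" "b \<in> B" for a b
  proof -
    have "(S1 + S2 + S3) \<xi> a b = 0" by (simp add: sum)
    then show ?thesis
      using that by (simp add: c blinfun.add_left blinfun.scaleR_left metric_tensor_frame split: if_splits)
  qed
  have S2_flip: "S2 \<xi> a b = S2 \<xi> b a" and S3_flip: "S3 \<xi> a b = - S3 \<xi> b a" for a b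
    using S2[unfolded Z2_iff, THEN conjunct2, THEN conjunct1, rule_format, of \<xi> a b]
      S3[unfolded Z3_iff, THEN conjunct2, rule_format, of \<xi> a b] by auto
  have "S3 \<xi> a b = 0" if "a \<in> B" "b \<in> B" for a b
    using coeff[OF that] coeff[OF that(2,1)] S2_flip[of a b] S3_flip[of a b] by (auto split: if_splits)
  then show "S3 = 0" by (intro ZV_eqI ZV) simp_all
  then have coeff: "(if a = b then c else 0) + S2 \<xi> a b = 0" if "a \<in> B" "b \<in> B" for a b
    using coeff[OF that] by simp
  have "(\<Sum>e\<in>B. S2 \<xi> e e) = (\<Sum>e\<in>B. - c)"
    using coeff by (intro sum.cong) (auto simp: add_eq_0_iff)
  then have "real (card B) * c = 0" using S2 by (simp add: Z2_iff)
  then have "B = {} \<or> c = 0" by simp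
  then show "S1 = 0" by (auto simp: c metric_tensor_def)
  show "S2 = 0" using coeff \<open>B = {} \<or> c = 0\<close>
    by (intro ZV_eqI ZV) (auto split: if_splits)
qed

lemma Z1_trivial:
  assumes "B = {}"
  shows "Z1 \<xi> = {0}"
proof -
  have "metric_tensor = 0" unfolding metric_tensor_def by (simp add: assms)
  then show ?thesis by (simp add: Z1_eq)
qed

lemma Z2_trivial:
  assumes "card B \<le> 1"
  shows "Z2 \<xi> = {0}"
proof -
  have "S = 0" if S: "S \<in> Z2 \<xi>" for S
  proof (rule ZV_eqI)
    fix a b assume "a \<in> B" "b \<in> B"
    with assms have "B = {a}" "b = a" by (auto simp: card_le_Suc0_iff_eq)
    with S show "S \<xi> a b = (0 :: 'a trilinear) \<xi> a b" by (simp add: Z2_iff)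
  qed (use S Z_subsets_ZV in \<open>auto simp: subspace_0 subspace_ZV\<close>)
  then show ?thesis using subspace_0[OF subspace_Z2] by auto
qed

lemma Z3_trivial:
  assumes "card B \<le> 1"
  shows "Z3 \<xi> = {0}"
proof -
  have "S = 0" if S: "S \<in> Z3 \<xi>" for S
  proof (rule ZV_eqI)
    fix a b assume "a \<in> B" "b \<in> B"
    with assms have "b = a" by (auto simp: card_le_Suc0_iff_eq)
    with S[unfolded Z3_iff, THEN conjunct2, rule_format, of \<xi> a b] show "S \<xi> a b = (0 :: 'a trilinear) \<xi> a b" by simp
  qed (use S Z_subsets_ZV in \<open>auto simp: subspace_0 subspace_ZV\<close>)
  then show ?thesis using subspace_0[OF subspace_Z3] by auto
qed

lemma Z1_irreducible:
  assumes "B \<noteq> {}"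
  shows "SO_irreducible \<xi> (Z1 \<xi>)"
  unfolding SO_irreducible_def
proof (intro conjI allI impI SO_submodule_Z1)
  obtain e where "e \<in> B" using assms by auto
  then have "metric_tensor \<xi> e e \<noteq> 0" by (simp add: metric_tensor_frame)
  then have "metric_tensor \<noteq> 0" by (metis blinfun.zero_left)
  moreover have "metric_tensor \<in> Z1 \<xi>" by (simp add: Z1_eq span_base)
  ultimately show "Z1 \<xi> \<noteq> {0}" by blast
  fix N assume N: "SO_submodule \<xi> N \<and> N \<subseteq> Z1 \<xi>"
  then have sub: "subspace N" by (simp add: SO_submodule_def)
  show "N = {0} \<or> N = Z1 \<xi>"
  proof (cases "N \<subseteq> {0}")
    case False
    then obtain S where S: "S \<in> N" "S \<noteq> 0" by auto
    then have "S \<in> span {metric_tensor}" using N by (auto simp: Z1_eq)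
    then obtain c where c: "S = c *\<^sub>R metric_tensor" by (auto simp: span_singleton)
    with S(2) have "c \<noteq> 0" by auto
    then have "metric_tensor = inverse c *\<^sub>R S" by (simp add: c)
    then have "metric_tensor \<in> N" using subspace_scale[OF sub S(1)] by metis
    then have "Z1 \<xi> \<subseteq> N" unfolding Z1_eq by (intro span_minimal sub) simp
    with N show ?thesis by auto
  qed (use subspace_0[OF sub] in auto)
qed

end

section \<open>Rotated tensors and their spans\<close>

context adapted_frame
begin

text \<open>
  The group acts on tensors through inverses, and the inverse of a rotation has the opposite sine.
  With \<open>-s\<close> here, \<open>rotate_tensor u v c s S\<close> evaluates \<open>S\<close> on arguments rotated by \<open>(c, s)\<close>.
\<close>

definition rotate_tensor :: "'a \<Rightarrow> 'a \<Rightarrow> real \<Rightarrow> real \<Rightarrow> 'a trilinear \<Rightarrow> 'a trilinear"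
  where "rotate_tensor u v c s = tensor_act (rot u v c (- s))"

lemma rot_frame:
  assumes "u \<in> B" "v \<in> B" "u \<noteq> v" "a \<in> B"
  shows "rot u v c s a = (if a = u then c *\<^sub>R u + s *\<^sub>R v else if a = v then c *\<^sub>R v - s *\<^sub>R u else a)"
  using assms by (simp add: rot_def frame_inner algebra_simps)

lemma rot_inner:
  assumes "u \<in> B" "v \<in> B" "u \<noteq> v"
  shows "rot u v c s x \<bullet> u = c * (x \<bullet> u) - s * (x \<bullet> v)"
    and "rot u v c s x \<bullet> v = c * (x \<bullet> v) + s * (x \<bullet> u)"
    and "w \<in> B \<Longrightarrow> w \<noteq> u \<Longrightarrow> w \<noteq> v \<Longrightarrow> rot u v c s x \<bullet> w = x \<bullet> w"
    and "rot u v c s x \<bullet> \<xi> = x \<bullet> \<xi>"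
  using assms by (simp_all add: rot_def inner_add_left frame_inner algebra_simps)

lemma rot_frame_SO_D:
  assumes "u \<in> B" "v \<in> B" "u \<noteq> v" "c\<^sup>2 + s\<^sup>2 = 1"
  shows "rot u v c s \<in> SO_D \<xi>"
  using assms by (intro rot_mem_SO_D) (simp_all add: frame_norm frame_inner)

lemma rotate_tensor_mem:
  assumes "SO_submodule \<xi> N" "S \<in> N" "u \<in> B" "v \<in> B" "u \<noteq> v" "c\<^sup>2 + s\<^sup>2 = 1"
  shows "rotate_tensor u v c s S \<in> N"
  using assms rot_frame_SO_D[of u v c "- s"] by (simp add: SO_submodule_def rotate_tensor_def)

lemma rotate_tensor_apply:
  assumes "S \<in> ZV \<xi>" "u \<in> B" "v \<in> B" "u \<noteq> v" "c\<^sup>2 + s\<^sup>2 = 1"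
  shows "rotate_tensor u v c s S X Y Z = S X (rot u v c s Y) (rot u v c s Z)"
proof -
  have "inv (rot u v c (- s)) = rot u v c s"
    using inv_rot[of u v c "- s"] assms(2-5) by (simp add: frame_norm frame_inner)
  then have "rotate_tensor u v c s S X Y Z = S (rot u v c s X) (rot u v c s Y) (rot u v c s Z)"
    using SO_D_inv(4)[OF rot_frame_SO_D[of u v c "- s"]] assms(2-5) by (simp add: rotate_tensor_def)
  also have "\<dots> = (X \<bullet> \<xi>) * S \<xi> (rot u v c s Y) (rot u v c s Z)"
    by (subst ZV_factor[OF assms(1)]) (simp add: rot_inner(4)[OF assms(2-4)])
  also have "\<dots> = S X (rot u v c s Y) (rot u v c s Z)"
    by (rule ZV_factor[OF assms(1), symmetric])
  finally show ?thesis .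
qed

definition diff_tensor :: "'a \<Rightarrow> 'a \<Rightarrow> 'a trilinear"
  where "diff_tensor u v = elem_tensor \<xi> u u - elem_tensor \<xi> v v"

lemma diff_tensor_apply:
  "diff_tensor u v X Y Z = (X \<bullet> \<xi>) * ((Y \<bullet> u) * (Z \<bullet> u) - (Y \<bullet> v) * (Z \<bullet> v))"
  by (simp add: diff_tensor_def blinfun.diff_left elem_tensor_apply algebra_simps)

lemma diff_tensor_mem_ZV: "u \<in> B \<Longrightarrow> v \<in> B \<Longrightarrow> diff_tensor u v \<in> ZV \<xi>"
  by (simp add: diff_tensor_def subspace_diff subspace_ZV elem_tensor_mem_ZV)

end

text \<open>
  Only \<open>N \<subseteq> ZV \<xi>\<close> is required, so that the lemmas on rotated generators serve submodules of \<open>Z2\<close> and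
  of \<open>Z3\<close> alike.
\<close>

locale ZV_submodule = adapted_frame \<xi> B for \<xi> :: "'a::euclidean_space" and B +
  fixes N :: "'a trilinear set"
  assumes submodule: "SO_submodule \<xi> N" and sub_ZV: "N \<subseteq> ZV \<xi>"
begin

lemma subspace: "subspace N"
  using submodule by (simp add: SO_submodule_def)

lemma mem_ZV: "S \<in> N \<Longrightarrow> S \<in> ZV \<xi>"
  using sub_ZV by blast

lemma scaled_mem: "c *\<^sub>R S \<in> N \<Longrightarrow> c \<noteq> 0 \<Longrightarrow> S \<in> N"
  using subspace_scale[OF subspace, of "c *\<^sub>R S" "inverse c"] by simp

text \<open>
  The quarter turn in the plane of \<open>j\<close> and \<open>l\<close> maps the tensor of the pair \<open>(i, j)\<close> to minus that of
  \<open>(i, l)\<close>.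
\<close>

lemma pair_tensor_step:
  assumes "pair_tensor \<epsilon> i j \<in> N" "i \<in> B" "j \<in> B" "l \<in> B" "j \<noteq> i" "l \<noteq> i"
  shows "pair_tensor \<epsilon> i l \<in> N"
proof (cases "l = j")
  case False
  have "rotate_tensor j l 0 1 (pair_tensor \<epsilon> i j) = - pair_tensor \<epsilon> i l"
    using assms False
    by (intro blinfun_eqI)
      (simp add: rotate_tensor_apply mem_ZV pair_tensor_apply rot_inner blinfun.minus_left algebra_simps)
  moreover have "rotate_tensor j l 0 1 (pair_tensor \<epsilon> i j) \<in> N"
    using assms False by (intro rotate_tensor_mem submodule) auto
  ultimately show ?thesis using subspace_neg[OF subspace] by force
qed (use assms in simp)

text \<open>
  Replacing one index at a time, from either side, leads from any pair of distinct indices to any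
  other.
\<close>

lemma pair_tensor_connected:
  assumes ij: "pair_tensor \<epsilon> i j \<in> N" "i \<in> B" "j \<in> B" "i \<noteq> j" and "\<epsilon> * \<epsilon> = 1"
    and kl: "k \<in> B" "l \<in> B" "k \<noteq> l"
  shows "pair_tensor \<epsilon> k l \<in> N"
proof -
  have swap: "pair_tensor \<epsilon> b a \<in> N" if "pair_tensor \<epsilon> a b \<in> N" for a b
  proof -
    have "pair_tensor \<epsilon> b a = \<epsilon> *\<^sub>R pair_tensor \<epsilon> a b"
      using \<open>\<epsilon> * \<epsilon> = 1\<close> by (simp add: pair_tensor_def scaleR_add_right add.commute)
    then show ?thesis using that subspace_scale[OF subspace] by metis
  qed
  note step = pair_tensor_step[of \<epsilon>]
  show ?thesis
  proof (cases "l = i")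
    case False
    then have "pair_tensor \<epsilon> i l \<in> N" using step ij kl by metis
    then show ?thesis using swap step ij kl False by metis
  next
    case True
    then have "pair_tensor \<epsilon> l j \<in> N" using ij by simp
    then show ?thesis using swap step ij kl True by metis
  qed
qed

text \<open>
  The traceless symmetric forms on a plane are themselves a plane, in which rotation of the original
  plane by an angle \<open>t\<close> acts as rotation by \<open>2 t\<close>.  The eighth turn therefore acts as a quarter turn,
  and a nonzero vector of this plane spans it together with its quarter turn.
\<close>

lemma planar_split:
  assumes "b *\<^sub>R pair_tensor 1 u v + a *\<^sub>R diff_tensor u v \<in> N" (is "?C \<in> N")
    and uv: "u \<in> B" "v \<in> B" "u \<noteq> v" and nz: "a \<noteq> 0 \<or> b \<noteq> 0"
  shows "pair_tensor 1 u v \<in> N" "diff_tensor u v \<in> N"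
proof -
  define r where "r = 1 / sqrt 2"
  have r: "r * r = 1 / 2" "r\<^sup>2 + r\<^sup>2 = 1" by (simp_all add: r_def power2_eq_square)
  define R where "R = rotate_tensor u v r r ?C"
  have R: "R \<in> N" unfolding R_def using assms r by (intro rotate_tensor_mem submodule)
  have R_eq: "R = b *\<^sub>R diff_tensor u v - a *\<^sub>R pair_tensor 1 u v"
  proof (intro blinfun_eqI)
    fix X Y Z
    let ?y = "Y \<bullet> u" and ?y' = "Y \<bullet> v" and ?z = "Z \<bullet> u" and ?z' = "Z \<bullet> v"
    have "R X Y Z = (X \<bullet> \<xi>) * (b * ((r * ?y - r * ?y') * (r * ?z' + r * ?z) + (r * ?y' + r * ?y) * (r * ?z - r * ?z'))
      + a * ((r * ?y - r * ?y') * (r * ?z - r * ?z') - (r * ?y' + r * ?y) * (r * ?z' + r * ?z)))"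
      using uv unfolding R_def rotate_tensor_apply[OF mem_ZV[OF assms(1)] uv r(2)]
      by (simp add: blinfun.add_left blinfun.scaleR_left pair_tensor_apply diff_tensor_apply rot_inner
          distrib_left mult_ac)
    also have "\<dots> = (X \<bullet> \<xi>) * ((r * r) * (b * ((?y - ?y') * (?z' + ?z) + (?y' + ?y) * (?z - ?z'))
      + a * ((?y - ?y') * (?z - ?z') - (?y' + ?y) * (?z' + ?z))))"
      by (simp add: algebra_simps)
    also have "\<dots> = (b *\<^sub>R diff_tensor u v - a *\<^sub>R pair_tensor 1 u v) X Y Z"
      by (simp add: r blinfun.diff_left blinfun.scaleR_left pair_tensor_apply diff_tensor_apply field_simps)
    finally show "R X Y Z = (b *\<^sub>R diff_tensor u v - a *\<^sub>R pair_tensor 1 u v) X Y Z" .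
  qed
  have pos: "a * a + b * b \<noteq> 0" using nz by (simp add: sum_squares_eq_zero_iff)
  have "b *\<^sub>R ?C - a *\<^sub>R R = (a * a + b * b) *\<^sub>R pair_tensor 1 u v"
    by (simp add: R_eq algebra_simps)
  moreover have "b *\<^sub>R ?C - a *\<^sub>R R \<in> N"
    by (intro subspace_diff subspace_scale subspace assms(1) R)
  ultimately show "pair_tensor 1 u v \<in> N" using scaled_mem pos by metis
  have "a *\<^sub>R ?C + b *\<^sub>R R = (a * a + b * b) *\<^sub>R diff_tensor u v"
    by (simp add: R_eq algebra_simps)
  moreover have "a *\<^sub>R ?C + b *\<^sub>R R \<in> N"
    by (intro subspace_add subspace_scale subspace assms(1) R)
  ultimately show "diff_tensor u v \<in> N" using scaled_mem pos by metis
qed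

text \<open>
  Let \<open>J\<close> be the quarter turn in the plane of \<open>u\<close> and \<open>v\<close>.  A symmetric form decomposes under the
  rotations of this plane into parts of weight \<open>0\<close>, \<open>1\<close> and \<open>2\<close>, on which \<open>J\<close> has the eigenvalues
  \<open>1\<close>, \<open>\<plusminus> \<i>\<close> and \<open>-1\<close>.  Hence \<open>(1 - J + J\<^sup>2 - J\<^sup>3) / 4\<close> is the projection to weight \<open>2\<close>, that is,
  to the traceless symmetric forms on the plane.
\<close>

lemma planar_projection:
  assumes S: "S \<in> N" and flip: "\<And>Y Z. S \<xi> Y Z = S \<xi> Z Y"
    and uv: "u \<in> B" "v \<in> B" "u \<noteq> v"
  shows "S \<xi> u v *\<^sub>R pair_tensor 1 u v + ((S \<xi> u u - S \<xi> v v) / 2) *\<^sub>R diff_tensor u v \<in> N"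
proof -
  define J where "J = rotate_tensor u v 0 1"
  have J: "J T \<in> N" if "T \<in> N" for T
    unfolding J_def using that uv by (intro rotate_tensor_mem submodule) auto
  have J_apply: "J T \<xi> Y Z = T \<xi> (rot u v 0 1 Y) (rot u v 0 1 Z)" if "T \<in> N" for T Y Z
    unfolding J_def using that uv by (intro rotate_tensor_apply mem_ZV) auto
  define P where "P = (1 / 4) *\<^sub>R (S - J S + J (J S) - J (J (J S)))"
  have P: "P \<in> N"
    unfolding P_def by (intro subspace_scale subspace_add subspace_diff subspace J S)
  have "P = S \<xi> u v *\<^sub>R pair_tensor 1 u v + ((S \<xi> u u - S \<xi> v v) / 2) *\<^sub>R diff_tensor u v"
  proof (rule ZV_eqI)
    show "S \<xi> u v *\<^sub>R pair_tensor 1 u v + ((S \<xi> u u - S \<xi> v v) / 2) *\<^sub>R diff_tensor u v \<in> ZV \<xi>"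
      using uv by (intro subspace_scale subspace_add subspace_ZV pair_tensor_mem_ZV diff_tensor_mem_ZV)
    have rot: "rot u v 0 1 u = v" "rot u v 0 1 v = - u" "rot u v 0 1 (- u) = - v"
      "rot u v 0 1 (- v) = u"
      and rot_fix: "\<And>a. a \<in> B \<Longrightarrow> a \<noteq> u \<Longrightarrow> a \<noteq> v \<Longrightarrow> rot u v 0 1 a = a"
      using uv by (simp_all add: rot_def frame_inner)
    note simps = P_def J J_apply S rot rot_fix frame_inner uv uv(3)[symmetric]
      blinfun.add_left blinfun.diff_left blinfun.scaleR_left blinfun.minus_left blinfun.minus_right
      diff_divide_distrib pair_tensor_apply diff_tensor_apply
    fix a b assume ab: "a \<in> B" "b \<in> B"
    consider "a = u" "b = u" | "a = u" "b = v" | "a = v" "b = u" | "a = v" "b = v"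
      | "a = u" "b \<noteq> u" "b \<noteq> v" | "a = v" "b \<noteq> u" "b \<noteq> v"
      | "a \<noteq> u" "a \<noteq> v" "b = u" | "a \<noteq> u" "a \<noteq> v" "b = v"
      | "a \<noteq> u" "a \<noteq> v" "b \<noteq> u" "b \<noteq> v" by blast
    then show "P \<xi> a b = (S \<xi> u v *\<^sub>R pair_tensor 1 u v + ((S \<xi> u u - S \<xi> v v) / 2) *\<^sub>R diff_tensor u v) \<xi> a b"
      by cases (use ab flip[of v u] in \<open>simp_all add: simps\<close>)
  qed (rule mem_ZV[OF P])
  then show ?thesis using P by simp
qed

text \<open>
  A nonzero traceless symmetric form has, in any frame, a nonzero off-diagonal entry or two distinct
  diagonal entries: a form whose matrix is scalar and has trace \<open>0\<close> is zero.  The projection to the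
  corresponding plane is then nonzero and gives one generator of each kind, rotations give all of
  them, and these span \<open>Z2\<close>.
\<close>

lemma Z2_sub:
  assumes NZ: "N \<subseteq> Z2 \<xi>" and S: "S \<in> N" "S \<noteq> 0"
  shows "Z2 \<xi> \<subseteq> N"
proof -
  have flip: "S X Y Z = S X Z Y" if "S \<in> Z2 \<xi>" for S X Y Z
    by (rule that[unfolded Z2_iff, THEN conjunct2, THEN conjunct1, rule_format])
  have SZ: "S \<in> Z2 \<xi>" using NZ S by blast
  have "\<exists>u\<in>B. \<exists>v\<in>B. u \<noteq> v \<and> (S \<xi> u v \<noteq> 0 \<or> S \<xi> u u \<noteq> S \<xi> v v)"
  proof (rule ccontr)
    assume *: "\<not> ?thesis"
    have off: "S \<xi> u v = 0" if "u \<in> B" "v \<in> B" "u \<noteq> v" for u v using * that by blast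
    have diag: "S \<xi> u u = S \<xi> v v" if "u \<in> B" "v \<in> B" for u v
      using * that by (cases "u = v") blast+
    have trace: "(\<Sum>e\<in>B. S \<xi> e e) = 0"
      by (rule SZ[unfolded Z2_iff, THEN conjunct2, THEN conjunct2])
    have "S \<xi> a b = 0" if a: "a \<in> B" and b: "b \<in> B" for a b
    proof (cases "a = b")
      case True
      have "(\<Sum>e\<in>B. S \<xi> e e) = (\<Sum>e\<in>B. S \<xi> a a)"
        by (intro sum.cong refl diag a)
      then have "real (card B) * S \<xi> a a = 0" using trace by simp
      moreover have "card B \<noteq> 0" using a by auto
      ultimately show ?thesis using True by simp
    qed (rule off[OF a b])
    then have "S = 0"
      by (intro ZV_eqI[OF mem_ZV[OF S(1)] subspace_0[OF subspace_ZV]]) simp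
    with S(2) show False by simp
  qed
  then obtain u v where uv: "u \<in> B" "v \<in> B" "u \<noteq> v" and "S \<xi> u v \<noteq> 0 \<or> S \<xi> u u \<noteq> S \<xi> v v"
    by blast
  then have "pair_tensor 1 u v \<in> N"
    by (intro planar_split(1)[OF planar_projection[OF S(1) flip[OF SZ] uv] uv]) auto
  then have pair: "pair_tensor 1 a b \<in> N" if "a \<in> B" "b \<in> B" "a \<noteq> b" for a b
    using pair_tensor_connected[of 1 u v a b] uv that by simp
  have diff: "diff_tensor a b \<in> N" if "a \<in> B" "b \<in> B" for a b
  proof (cases "a = b")
    case True
    then show ?thesis using subspace_0[OF subspace] by (simp add: diff_tensor_def)
  next
    case False
    then show ?thesis using planar_split(2)[of 1 a b 0] pair that by simp
  qed
  show ?thesis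
  proof
    fix T assume T: "T \<in> Z2 \<xi>"
    have trace: "(\<Sum>e\<in>B. T \<xi> e e) = 0" using T by (simp add: Z2_iff)
    \<comment> \<open>Subtracting the same tensor from each diagonal term changes nothing, as the trace is \<open>0\<close>, but it
      turns all the terms into multiples of generators.\<close>
    have "(\<Sum>a\<in>B. \<Sum>b\<in>B. (T \<xi> a b / 2) *\<^sub>R (pair_tensor 1 a b - (if a = b then 2 *\<^sub>R elem_tensor \<xi> u u else 0)))
      = (\<Sum>a\<in>B. \<Sum>b\<in>B. (T \<xi> a b / 2) *\<^sub>R pair_tensor 1 a b)
        - (\<Sum>a\<in>B. \<Sum>b\<in>B. if a = b then T \<xi> a b *\<^sub>R elem_tensor \<xi> u u else 0)"
      unfolding sum_subtractf[symmetric] by (intro sum.cong refl) (simp add: scaleR_diff_right)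
    also have "(\<Sum>a\<in>B. \<Sum>b\<in>B. if a = b then T \<xi> a b *\<^sub>R elem_tensor \<xi> u u else 0) =
      (\<Sum>e\<in>B. T \<xi> e e) *\<^sub>R elem_tensor \<xi> u u"
      by (simp add: scaleR_sum_left)
    also have "(\<Sum>a\<in>B. \<Sum>b\<in>B. (T \<xi> a b / 2) *\<^sub>R pair_tensor 1 a b) = T"
      using T Z_subsets_ZV by (intro pair_expand[symmetric]) (auto intro: flip[OF T])
    finally have expand: "(\<Sum>a\<in>B. \<Sum>b\<in>B. (T \<xi> a b / 2) *\<^sub>R
        (pair_tensor 1 a b - (if a = b then 2 *\<^sub>R elem_tensor \<xi> u u else 0))) = T"
      unfolding trace scaleR_zero_left diff_zero .
    have mem: "pair_tensor 1 a b - (if a = b then 2 *\<^sub>R elem_tensor \<xi> u u else 0) \<in> N"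
      if "a \<in> B" "b \<in> B" for a b
    proof (cases "a = b")
      case True
      then have "pair_tensor 1 a b - (if a = b then 2 *\<^sub>R elem_tensor \<xi> u u else 0) = 2 *\<^sub>R diff_tensor a u"
        by (simp add: pair_tensor_def diff_tensor_def scaleR_2 algebra_simps)
      then show ?thesis using diff that uv subspace_scale[OF subspace] by simp
    qed (use pair that in simp)
    show "T \<in> N"
      by (subst expand[symmetric]) (intro subspace_sum subspace_scale subspace mem)
  qed
qed

text \<open>
  The half turn \<open>H\<close> in the plane of \<open>u\<close> and \<open>v\<close> changes the sign of these two frame vectors, so
  \<open>(1 - H) / 2\<close> keeps the entries with exactly one index in \<open>{u, v}\<close> and deletes all the others.
\<close>

lemma mixed_projection:
  assumes S: "S \<in> N" and uv: "u \<in> B" "v \<in> B" "u \<noteq> v"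
  obtains S' where "S' \<in> N"
    and "\<And>a b. a \<in> B \<Longrightarrow> b \<in> B \<Longrightarrow> S' \<xi> a b = (if (a \<in> {u, v}) \<noteq> (b \<in> {u, v}) then S \<xi> a b else 0)"
proof
  let ?R = "rotate_tensor u v (-1) 0 S" and ?S' = "(1 / 2) *\<^sub>R (S - rotate_tensor u v (-1) 0 S)"
  have "?R \<in> N" using S uv by (intro rotate_tensor_mem submodule) auto
  then show "?S' \<in> N" by (intro subspace_scale subspace_diff subspace S)
  fix a b assume ab: "a \<in> B" "b \<in> B"
  have rot: "rot u v (-1) 0 w = (if w \<in> {u, v} then - w else w)" if "w \<in> B" for w
    using that uv by (simp add: rot_frame)
  have "?R \<xi> a b = S \<xi> (rot u v (-1) 0 a) (rot u v (-1) 0 b)"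
    using S uv by (intro rotate_tensor_apply mem_ZV) auto
  then show "?S' \<xi> a b = (if (a \<in> {u, v}) \<noteq> (b \<in> {u, v}) then S \<xi> a b else 0)"
    unfolding rot[OF ab(1)] rot[OF ab(2)]
    by (simp add: blinfun.scaleR_left blinfun.diff_left blinfun.minus_left blinfun.minus_right)
qed

text \<open>
  In dimension \<open>2\<close> a skew form has a single entry, up to the order of the indices.  In higher
  dimensions, mixed projections isolate a nonzero entry \<open>(i, k)\<close>.  Those for \<open>{i, j}\<close> and \<open>{k, j}\<close>
  keep, again up to order, only \<open>(i, k)\<close> and the entries \<open>(j, l)\<close> with \<open>l\<close> outside
  \<open>{i, j, k}\<close>; in dimension \<open>3\<close> there is no such \<open>l\<close>.  In dimension at least \<open>5\<close> there are two further
  indices \<open>j'\<close> and \<open>j''\<close>, and those for \<open>{i, j'}\<close> and \<open>{i, j''}\<close> keep \<open>(i, k)\<close>, whereas an entry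
  \<open>(j, l)\<close> would need \<open>l = j'\<close> and \<open>l = j''\<close>.  In dimension \<open>4\<close> the entry \<open>(j, l)\<close> is the Hodge dual of
  \<open>(i, k)\<close>, and the two cannot be separated inside every submodule: the self-dual and the
  anti-self-dual forms are invariant.
\<close>

lemma Z3_sub:
  assumes NZ: "N \<subseteq> Z3 \<xi>" and S: "S \<in> N" "S \<noteq> 0" and "card B \<noteq> 4"
  shows "Z3 \<xi> \<subseteq> N"
proof -
  have flip: "T X Y Z = - T X Z Y" if "T \<in> Z3 \<xi>" for T X Y Z
    by (rule that[unfolded Z3_iff, THEN conjunct2, rule_format])
  have diag: "T \<xi> a a = 0" if "T \<in> Z3 \<xi>" for T a
    using flip[OF that, of \<xi> a a] by simp
  have "\<exists>i\<in>B. \<exists>k\<in>B. S \<xi> i k \<noteq> 0"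
  proof (rule ccontr)
    assume "\<not> ?thesis"
    then have "S = 0"
      by (intro ZV_eqI[OF mem_ZV[OF S(1)] subspace_0[OF subspace_ZV]]) simp
    with S show False by simp
  qed
  then obtain i k where ik: "i \<in> B" "k \<in> B" and nz: "S \<xi> i k \<noteq> 0" by blast
  have "i \<noteq> k" using nz diag S(1) NZ by blast
  have isolate: "pair_tensor (-1) i k \<in> N"
    if T: "T \<in> N" "T \<xi> i k \<noteq> 0" and
      zero: "\<And>a b. a \<in> B \<Longrightarrow> b \<in> B \<Longrightarrow> \<not> (a = i \<and> b = k) \<Longrightarrow> \<not> (a = k \<and> b = i) \<Longrightarrow> T \<xi> a b = 0" for T
  proof -
    have "T = T \<xi> i k *\<^sub>R pair_tensor (-1) i k"
    proof (rule ZV_eqI)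
      show "T \<xi> i k *\<^sub>R pair_tensor (-1) i k \<in> ZV \<xi>"
        using ik by (intro subspace_scale subspace_ZV pair_tensor_mem_ZV)
      fix a b assume ab: "a \<in> B" "b \<in> B"
      have "T \<xi> k i = - T \<xi> i k" using flip NZ T by blast
      then show "T \<xi> a b = (T \<xi> i k *\<^sub>R pair_tensor (-1) i k) \<xi> a b"
        using ab ik zero[OF ab] \<open>i \<noteq> k\<close>
        by (auto simp: blinfun.scaleR_left pair_tensor_apply frame_inner)
    qed (use T mem_ZV in blast)
    then show ?thesis using T scaled_mem by metis
  qed
  have "pair_tensor (-1) i k \<in> N"
  proof (cases "B = {i, k}")
    case True
    have "S \<xi> a a = 0" for a using diag NZ S by blast
    with True show ?thesis by (intro isolate[OF S(1) nz]) auto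
  next
    case False
    then obtain j where j: "j \<in> B" "j \<noteq> i" "j \<noteq> k" using ik by blast
    obtain S1 where S1: "S1 \<in> N"
      "\<And>a b. a \<in> B \<Longrightarrow> b \<in> B \<Longrightarrow> S1 \<xi> a b = (if (a \<in> {i, j}) \<noteq> (b \<in> {i, j}) then S \<xi> a b else 0)"
      using mixed_projection[OF S(1) ik(1) j(1)] j by metis
    obtain S2 where S2: "S2 \<in> N"
      "\<And>a b. a \<in> B \<Longrightarrow> b \<in> B \<Longrightarrow> S2 \<xi> a b = (if (a \<in> {k, j}) \<noteq> (b \<in> {k, j}) then S1 \<xi> a b else 0)"
      using mixed_projection[OF S1(1) ik(2) j(1)] j by metis
    have S2_ik: "S2 \<xi> i k \<noteq> 0" using ik j nz \<open>i \<noteq> k\<close> by (simp add: S1 S2)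
    have S2_zero: "S2 \<xi> a b = 0" if "a \<in> B" "b \<in> B" "\<not> (a = i \<and> b = k)" "\<not> (a = k \<and> b = i)"
      "a \<noteq> j" "b \<noteq> j" for a b
      using that \<open>i \<noteq> k\<close> by (auto simp: S1 S2)
    have S2_zero': "S2 \<xi> a b = 0" if "a \<in> B" "b \<in> B" "a = j \<or> b = j" "a \<in> {i, k} \<or> b \<in> {i, k}" for a b
      using that j \<open>i \<noteq> k\<close> by (auto simp: S1 S2)
    show ?thesis
    proof (cases "B = {i, j, k}")
      case True
      have "S2 \<xi> a a = 0" for a using diag NZ S2 by blast
      then show ?thesis
        using True S2_zero S2_zero' by (intro isolate[OF S2(1) S2_ik]) blast
    next
      case False
      then obtain j' where j': "j' \<in> B" "j' \<noteq> i" "j' \<noteq> k" "j' \<noteq> j" using ik j by blast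
      have "card {i, j, k, j'} = 4" using j j' \<open>i \<noteq> k\<close> by auto
      then have "B \<noteq> {i, j, k, j'}" using \<open>card B \<noteq> 4\<close> by metis
      then obtain j'' where j'': "j'' \<in> B" "j'' \<noteq> i" "j'' \<noteq> k" "j'' \<noteq> j" "j'' \<noteq> j'"
        using ik j j' by blast
      obtain S3 where S3: "S3 \<in> N"
        "\<And>a b. a \<in> B \<Longrightarrow> b \<in> B \<Longrightarrow> S3 \<xi> a b = (if (a \<in> {i, j'}) \<noteq> (b \<in> {i, j'}) then S2 \<xi> a b else 0)"
        using mixed_projection[OF S2(1) ik(1) j'(1)] j' by metis
      obtain S4 where S4: "S4 \<in> N"
        "\<And>a b. a \<in> B \<Longrightarrow> b \<in> B \<Longrightarrow> S4 \<xi> a b = (if (a \<in> {i, j''}) \<noteq> (b \<in> {i, j''}) then S3 \<xi> a b else 0)"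
        using mixed_projection[OF S3(1) ik(1) j''(1)] j'' by metis
      show ?thesis
      proof (rule isolate[OF S4(1)])
        show "S4 \<xi> i k \<noteq> 0" using ik j' j'' S2_ik \<open>i \<noteq> k\<close> by (simp add: S3 S4)
        fix a b assume ab: "a \<in> B" "b \<in> B" "\<not> (a = i \<and> b = k)" "\<not> (a = k \<and> b = i)"
        show "S4 \<xi> a b = 0"
        proof (cases "a = j \<or> b = j")
          case True
          then show ?thesis using ab j j' j'' S2_zero'[OF ab(1,2)] by (auto simp: S3 S4)
        next
          case False
          then show ?thesis using S2_zero[OF ab] ab by (simp add: S3 S4)
        qed
      qed
    qed
  qed
  then have pair: "pair_tensor (-1) a b \<in> N" if "a \<in> B" "b \<in> B" for a b
  proof (cases "a = b")
    case True
    then show ?thesis using subspace_0[OF subspace] by (simp add: pair_tensor_def)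
  next
    case False
    then show ?thesis
      using pair_tensor_connected[of "-1" i k a b] ik \<open>i \<noteq> k\<close> that \<open>pair_tensor (-1) i k \<in> N\<close> by simp
  qed
  show ?thesis
  proof
    fix T assume T: "T \<in> Z3 \<xi>"
    then have "T = (\<Sum>a\<in>B. \<Sum>b\<in>B. (T \<xi> a b / 2) *\<^sub>R pair_tensor (-1) a b)"
      using Z_subsets_ZV by (intro pair_expand) (auto intro: flip)
    also have "\<dots> \<in> N" by (intro subspace_sum subspace_scale subspace pair)
    finally show "T \<in> N" .
  qed
qed

end

context adapted_frame
begin

lemma SO_irreducibleI:
  assumes M: "SO_submodule \<xi> M" "M \<subseteq> ZV \<xi>" "S0 \<in> M" "S0 \<noteq> 0"
    and gen: "\<And>N S. ZV_submodule \<xi> B N \<Longrightarrow> N \<subseteq> M \<Longrightarrow> S \<in> N \<Longrightarrow> S \<noteq> 0 \<Longrightarrow> M \<subseteq> N"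
  shows "SO_irreducible \<xi> M"
  unfolding SO_irreducible_def
proof (intro conjI allI impI M(1))
  show "M \<noteq> {0}" using M by blast
  fix N assume N: "SO_submodule \<xi> N \<and> N \<subseteq> M"
  then have "ZV_submodule \<xi> B N"
    using M(2) by unfold_locales auto
  moreover have "0 \<in> N" using N by (simp add: SO_submodule_def subspace_0)
  ultimately show "N = {0} \<or> N = M" using gen N by blast
qed

lemma Z2_irreducible:
  assumes "2 \<le> card B"
  shows "SO_irreducible \<xi> (Z2 \<xi>)"
proof -
  obtain u v where uv: "u \<in> B" "v \<in> B" "u \<noteq> v"
    using assms by (metis card_2_iff' obtain_subset_with_card_n subsetD)
  have "pair_tensor 1 u v \<in> Z2 \<xi>"
    unfolding Z2_iff using uv pair_tensor_mem_ZV
    by (auto simp: pair_tensor_apply frame_inner algebra_simps intro!: sum.neutral)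
  moreover have "pair_tensor 1 u v \<xi> u v \<noteq> 0" using uv by (simp add: pair_tensor_apply frame_inner)
  then have "pair_tensor 1 u v \<noteq> 0" by (metis blinfun.zero_left)
  ultimately show ?thesis
    by (rule SO_irreducibleI[OF SO_submodule_Z2 Z_subsets_ZV(2)]) (rule ZV_submodule.Z2_sub)
qed

lemma Z3_irreducible:
  assumes "2 \<le> card B" "card B \<noteq> 4"
  shows "SO_irreducible \<xi> (Z3 \<xi>)"
proof -
  obtain u v where uv: "u \<in> B" "v \<in> B" "u \<noteq> v"
    using assms by (metis card_2_iff' obtain_subset_with_card_n subsetD)
  have "pair_tensor (-1) u v \<in> Z3 \<xi>" using uv by (simp add: pair_tensor_mem_Z3)
  moreover have "pair_tensor (-1) u v \<xi> u v \<noteq> 0" using uv by (simp add: pair_tensor_apply frame_inner)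
  then have "pair_tensor (-1) u v \<noteq> 0" by (metis blinfun.zero_left)
  ultimately show ?thesis
    by (rule SO_irreducibleI[OF SO_submodule_Z3 Z_subsets_ZV(3)]) (rule ZV_submodule.Z3_sub[OF _ _ _ _ assms(2)])
qed

end

section \<open>The decomposition into irreducible modules\<close>

theorem proposition5p4:
  fixes \<xi> :: "'a::euclidean_space" and n :: nat
  assumes "DIM('a) = n + 1" and "norm \<xi> = 1"
  shows "SO_submodule \<xi> (ZV \<xi>)
    \<and> SO_submodule \<xi> (Z1 \<xi>) \<and> SO_submodule \<xi> (Z2 \<xi>) \<and> SO_submodule \<xi> (Z3 \<xi>)
    \<and> ZV \<xi> = Z1 \<xi> + Z2 \<xi> + Z3 \<xi>
    \<and> (\<forall>S1\<in>Z1 \<xi>. \<forall>S2\<in>Z2 \<xi>. \<forall>S3\<in>Z3 \<xi>.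
          S1 + S2 + S3 = 0 \<longrightarrow> S1 = 0 \<and> S2 = 0 \<and> S3 = 0)
    \<and> (if n = 0 then Z1 \<xi> = {0} else SO_irreducible \<xi> (Z1 \<xi>))
    \<and> (if n \<le> 1 then Z2 \<xi> = {0} else SO_irreducible \<xi> (Z2 \<xi>))
    \<and> (if n \<le> 1 then Z3 \<xi> = {0} else n \<noteq> 4 \<longrightarrow> SO_irreducible \<xi> (Z3 \<xi>))"
proof -
  obtain B where "orthonormal_basis_of (dist_of \<xi>) B" using ex_orthonormal_basis_of by blast
  with assms(2) interpret adapted_frame \<xi> B by unfold_locales
  have n: "card B = n" using card_frame assms(1) by simp
  have "if n = 0 then Z1 \<xi> = {0} else SO_irreducible \<xi> (Z1 \<xi>)"
  proof (cases "n = 0")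
    case True
    then have "B = {}" using n by simp
    then show ?thesis using True Z1_trivial by simp
  next
    case False
    then have "B \<noteq> {}" using n by auto
    then show ?thesis using False Z1_irreducible by simp
  qed
  moreover have "if n \<le> 1 then Z2 \<xi> = {0} else SO_irreducible \<xi> (Z2 \<xi>)"
    using Z2_trivial Z2_irreducible unfolding n by simp
  moreover have "if n \<le> 1 then Z3 \<xi> = {0} else n \<noteq> 4 \<longrightarrow> SO_irreducible \<xi> (Z3 \<xi>)"
    using Z3_trivial Z3_irreducible unfolding n by simp
  ultimately show ?thesis
    using SO_submodule_ZV SO_submodule_Z1 SO_submodule_Z2 SO_submodule_Z3 ZV_decomposition ZV_direct
    by blast
qed

end
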